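(* Every strongly $\aleph_1$-free abelian group is n-slender, cm-slender, and lcH-slender.
   Context: An abelian group is $\aleph_1$-free abelian if every countable subgroup is free abelian. If $H$ is $\aleph_1$-free abelian, a subgroup $M\le H$ is $\aleph_1$-pure if $M$ is a direct summand of $\langle M\cup X\rangle$ for every countable set $X\subseteq H$. An $\aleph_1$-free abelian group $H$ is strongly $\aleph_1$-free abelian if every countable subset of $H$ is contained in a countably generated $\aleph_1$-pure subgroup of $H$. A group $H$ is cm-slender if every abstract homomorphism from a completely metrizable topological group to $H$ has open kernel; $H$ is lcH-slender if every abstract homomorphism from a locally compact Hausdorff topological group to $H$ has open kernel. The Hawaiian earring group $\mathcal{H}$: fix letters $\{a_n^{\pm1}\}_{n\in\omega}$. A word is a function $W:\overline{W}\to\{a_n^{\pm1}\}_{n\in\omega}$ whose domain $\overline{W}$ is a totally ordered set such that for each $m$ the preimage $W^{-1}(\{a_n^{\pm1}\}_{n=0}^m)$ is finite; words are identified up to order isomorphism of domains preserving letters. For $m\in\omega$, $p_m(W)$ is the restriction of $W$ to $\{i: W(i)\in\{a_n^{\pm1}\}_{n=0}^m\}$, a finite word. Two words $W,U$ are equivalent if for every $m$, $p_m(W)$ and $p_m(U)$ are equal in the free group $F(a_0,\dots,a_m)$. $\mathcal{H}$ is the set of equivalence classes with multiplication induced by concatenation (ordered disjoint union of domains, first word below second) and inverse induced by reversing the order and inverting letters. $p_m$ induces a retraction homomorphism $p_m:\mathcal{H}\to\mathcal{H}_m$ onto the subgroup $\mathcal{H}_m\cong F(a_0,\dots,a_m)$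 of classes of finite words in $a_0,\dots,a_m$. $\mathcal{H}^m$ denotes the subgroup of elements having a representative word using no letter from $\{a_n^{\pm1}\}_{n=0}^m$. A group $H$ is n-slender if for every homomorphism $\phi:\mathcal{H}\to H$ there is $m\in\omega$ with $\phi=\phi\circ p_m$, equivalently $\mathcal{H}^m\le\ker\phi$. *)

theory Defs
  imports "HOL-Analysis.Analysis" "HOL-Algebra.Free_Abelian_Groups"
begin

text \<open>A group is free abelian if it is isomorphic to the free abelian group on some set.
  The index set can always be taken inside the carrier type (a basis), so we quantify
  over index sets of the carrier type.\<close>
definition free_abelian :: "('a, 'm) monoid_scheme \<Rightarrow> bool" where
  "free_abelian K \<longleftrightarrow> comm_group K \<and> (\<exists>I :: 'a set. K \<cong> free_Abelian_group I)"

definition aleph1_free_abelian :: "('a, 'm) monoid_scheme \<Rightarrow> bool" where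
  "aleph1_free_abelian H \<longleftrightarrow> comm_group H \<and>
     (\<forall>S. subgroup S H \<and> countable S \<longrightarrow> free_abelian (subgroup_generated H S))"

definition direct_summand :: "('a, 'm) monoid_scheme \<Rightarrow> 'a set \<Rightarrow> 'a set \<Rightarrow> bool" where
  "direct_summand H M N \<longleftrightarrow> subgroup M H \<and> subgroup N H \<and> M \<subseteq> N \<and>
     (\<exists>C. subgroup C H \<and> C \<subseteq> N \<and> M \<inter> C = {\<one>\<^bsub>H\<^esub>} \<and> M <#>\<^bsub>H\<^esub> C = N)"

definition aleph1_pure :: "('a, 'm) monoid_scheme \<Rightarrow> 'a set \<Rightarrow> bool" where
  "aleph1_pure H M \<longleftrightarrow> subgroup M H \<and>
     (\<forall>X. X \<subseteq> carrier H \<and> countable X \<longrightarrow> direct_summand H M (generate H (M \<union> X)))"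

definition countably_generated_subgroup :: "('a, 'm) monoid_scheme \<Rightarrow> 'a set \<Rightarrow> bool" where
  "countably_generated_subgroup H M \<longleftrightarrow>
     (\<exists>X. X \<subseteq> carrier H \<and> countable X \<and> generate H X = M)"

definition strongly_aleph1_free_abelian :: "('a, 'm) monoid_scheme \<Rightarrow> bool" where
  "strongly_aleph1_free_abelian H \<longleftrightarrow> aleph1_free_abelian H \<and>
     (\<forall>X. X \<subseteq> carrier H \<and> countable X \<longrightarrow>
        (\<exists>M. X \<subseteq> M \<and> aleph1_pure H M \<and> countably_generated_subgroup H M))"

definition topological_group :: "('g, 'm) monoid_scheme \<Rightarrow> 'g topology \<Rightarrow> bool" where
  "topological_group G T \<longleftrightarrow> group G \<and> topspace T = carrier G \<and>
     continuous_map (prod_topology T T) T (\<lambda>(x, y). x \<otimes>\<^bsub>G\<^esub> y) \<and>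
     continuous_map T T (\<lambda>x. inv\<^bsub>G\<^esub> x)"

text \<open>The group type is passed as a parameter; every group is isomorphic to one
  whose carrier lives in some type, and the main theorem quantifies over all types.\<close>
definition cm_slender :: "('a, 'm) monoid_scheme \<Rightarrow> ('g \<times> 'n) itself \<Rightarrow> bool" where
  "cm_slender H _ \<longleftrightarrow> (\<forall>(G :: ('g, 'n) monoid_scheme) T f.
      topological_group G T \<and> completely_metrizable_space T \<and> f \<in> hom G H
      \<longrightarrow> openin T (kernel G H f))"

definition lcH_slender :: "('a, 'm) monoid_scheme \<Rightarrow> ('g \<times> 'n) itself \<Rightarrow> bool" where
  "lcH_slender H _ \<longleftrightarrow> (\<forall>(G :: ('g, 'n) monoid_scheme) T f.
      topological_group G T \<and> locally_compact_space T \<and> Hausdorff_space T \<and> f \<in> hom G H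
      \<longrightarrow> openin T (kernel G H f))"

text \<open>Letters: (n, True) is a_n and (n, False) is a_n^{-1}.
  A word is a partial function from the rationals to letters; its domain (with the order
  of the rationals) is the totally ordered index set.  Every countable linear order embeds
  in the rationals, and words are only considered up to order isomorphism, so this loses
  nothing (domains of words are necessarily countable).\<close>
type_synonym letter = "nat \<times> bool"
type_synonym hword = "rat \<Rightarrow> letter option"

definition inv_letter :: "letter \<Rightarrow> letter" where
  "inv_letter l = (fst l, \<not> snd l)"

definition hw_dom :: "hword \<Rightarrow> rat set" where
  "hw_dom W = {q. W q \<noteq> None}"

definition is_hword :: "hword \<Rightarrow> bool" where
  "is_hword W \<longleftrightarrow> (\<forall>m. finite {q. \<exists>l. W q = Some l \<and> fst l \<le> m})"

definition proj_list :: "nat \<Rightarrow> hword \<Rightarrow> letter list" where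
  "proj_list m W = map (\<lambda>q. the (W q)) (sorted_list_of_set {q. \<exists>l. W q = Some l \<and> fst l \<le> m})"

text \<open>Free reduction: two finite words are equal in the free group iff their
  free reductions coincide.\<close>
fun free_reduce :: "letter list \<Rightarrow> letter list" where
  "free_reduce [] = []"
| "free_reduce (x # xs) = (case free_reduce xs of
      [] \<Rightarrow> [x]
    | y # ys \<Rightarrow> (if y = inv_letter x then ys else x # y # ys))"

definition hw_equiv :: "hword \<Rightarrow> hword \<Rightarrow> bool" where
  "hw_equiv W U \<longleftrightarrow> (\<forall>m. free_reduce (proj_list m W) = free_reduce (proj_list m U))"

definition hw_class :: "hword \<Rightarrow> hword set" where
  "hw_class W = {U. is_hword U \<and> hw_equiv W U}"

text \<open>An order embedding of the rationals into the open interval (-1,1).\<close>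
definition squash :: "rat \<Rightarrow> rat" where
  "squash q = q / (1 + \<bar>q\<bar>)"

text \<open>Concatenation: first word placed in (-2,0), second word in (0,2).\<close>
definition hw_concat :: "hword \<Rightarrow> hword \<Rightarrow> hword" where
  "hw_concat W U = (\<lambda>q. if q < 0 then
       (if \<exists>r. squash r - 1 = q then W (THE r. squash r - 1 = q) else None)
     else (if \<exists>r. squash r + 1 = q then U (THE r. squash r + 1 = q) else None))"

definition hw_inverse :: "hword \<Rightarrow> hword" where
  "hw_inverse W = (\<lambda>q. map_option inv_letter (W (- q)))"

definition hw_restrict :: "nat \<Rightarrow> hword \<Rightarrow> hword" where
  "hw_restrict m W = (\<lambda>q. case W q of None \<Rightarrow> None
       | Some l \<Rightarrow> (if fst l \<le> m then Some l else None))"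

definition hw_rep :: "hword set \<Rightarrow> hword" where
  "hw_rep A = (SOME W. W \<in> A)"

definition hawaiian :: "hword set monoid" where
  "hawaiian = \<lparr> carrier = hw_class ` {W. is_hword W},
     mult = (\<lambda>A B. hw_class (hw_concat (hw_rep A) (hw_rep B))),
     one = hw_class (\<lambda>_. None) \<rparr>"

definition hawaiian_proj :: "nat \<Rightarrow> hword set \<Rightarrow> hword set" where
  "hawaiian_proj m A = hw_class (hw_restrict m (hw_rep A))"

definition n_slender :: "('a, 'm) monoid_scheme \<Rightarrow> bool" where
  "n_slender H \<longleftrightarrow> (\<forall>\<phi> \<in> hom hawaiian H. \<exists>m. \<forall>x \<in> carrier hawaiian.
       \<phi> x = \<phi> (hawaiian_proj m x))"

end

theory Submission
  imports Defs
begin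

text \<open>Let \<open>f\<close> be a homomorphism into a strongly \<open>\<aleph>\<^sub>1\<close>-free abelian group \<open>H\<close> for which the
  conclusion fails. Then there are elements \<open>g n\<close>, as small as desired, with \<open>f (g n) \<noteq> 1\<close>. Since
  \<open>H\<close> is \<open>\<aleph>\<^sub>1\<close>-free, some \<open>k n > 0\<close> does not divide \<open>f (g n)\<close>. If \<open>g (n + 1)\<close> is chosen small
  enough in terms of \<open>g i\<close> and \<open>k i\<close> for \<open>i \<le> n\<close>, then for every \<open>S \<subseteq> \<nat>\<close> the system
  \<open>x n = g n\<^bsup>[n \<in> S]\<^esup> \<cdot> x (n + 1) ^ k n\<close> is solvable: by a limit of partial products in a complete
  metric, by compactness in a locally compact group, and by an infinite word in the Hawaiian earring
  group. Take a countable \<open>\<aleph>\<^sub>1\<close>-pure subgroup \<open>M\<close> of \<open>H\<close> containing all \<open>f (g n)\<close>. The solution for a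
  fixed \<open>S\<close> is countable, so its image retracts to a solution in \<open>M\<close>. As \<open>M\<close> is countable, two
  different sets \<open>S\<close> yield the same value at \<open>0\<close>; torsion-freeness propagates the equality up to the
  first \<open>n\<close> where the two sets differ, and there \<open>f (g n)\<close> becomes divisible by \<open>k n\<close>.\<close>

section \<open>Strongly \<open>\<aleph>\<^sub>1\<close>-free abelian groups\<close>

lemma uncountable_UNIV_nat_set: "uncountable (UNIV :: nat set set)"
proof
  assume "countable (UNIV :: nat set set)"
  then have "range (from_nat_into (UNIV :: nat set set)) = Pow UNIV"
    by (simp add: range_from_nat_into)
  then show False
    using Cantors_theorem by blast
qed

lemma countable_generate:
  assumes "countable X"
  shows "countable (generate G X)"
proof -
  \<comment> \<open>\<open>generate\<close> inverts generators only, so stage 0 contains those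
    inverses and every later stage adds products.\<close>
  define A where "A = rec_nat (insert \<one>\<^bsub>G\<^esub> (X \<union> m_inv G ` X))
    (\<lambda>_ S. S \<union> (\<lambda>(a, b). a \<otimes>\<^bsub>G\<^esub> b) ` (S \<times> S))"
  have A0: "A 0 = insert \<one>\<^bsub>G\<^esub> (X \<union> m_inv G ` X)"
    and AS: "A (Suc n) = A n \<union> (\<lambda>(a, b). a \<otimes>\<^bsub>G\<^esub> b) ` (A n \<times> A n)" for n
    by (simp_all add: A_def)
  have cA: "countable (A n)" for n
    by (induction n) (use assms in \<open>auto simp: A0 AS\<close>)
  have mono: "A m \<subseteq> A n" if "m \<le> n" for m n
    using that by (rule lift_Suc_mono_le[rotated]) (simp add: AS)
  have "\<exists>n. x \<in> A n" if "x \<in> generate G X" for x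
    using that
  proof induction
    case (eng a b)
    then obtain i j where "a \<in> A i" "b \<in> A j"
      by blast
    then have "a \<in> A (max i j)" "b \<in> A (max i j)"
      using mono by (meson max.cobounded1 max.cobounded2 subsetD)+
    then have "a \<otimes>\<^bsub>G\<^esub> b \<in> A (Suc (max i j))"
      unfolding AS by blast
    then show ?case
      by blast
  qed (use A0 in blast)+
  then have "generate G X \<subseteq> (\<Union>n. A n)"
    by blast
  with cA show ?thesis
    by (meson countable_UN countable_subset uncountable_def countableI_type)
qed

section \<open>Torsion and divisibility in free and aleph_1-free abelian groups\<close>

lemma free_abelian_torsion_free:
  fixes K :: "('a, 'm) monoid_scheme"
  assumes "free_abelian K" "x \<in> carrier K" "0 < k" "x [^]\<^bsub>K\<^esub> (k::nat) = \<one>\<^bsub>K\<^esub>"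
  shows "x = \<one>\<^bsub>K\<^esub>"
proof -
  obtain I :: "'a set" and i where K: "comm_group K" and i: "i \<in> iso K (free_Abelian_group I)"
    using assms(1) unfolding free_abelian_def is_iso_def by blast
  interpret K: comm_group K by (fact K)
  interpret i: group_hom K "free_Abelian_group I" i
    using i by (auto simp: group_hom_def group_hom_axioms_def iso_def)
  have "frag_cmul (int k) (i x) = 0"
    using i.hom_nat_pow[OF assms(2), of k] i.hom_closed[OF assms(2)] assms(4) by simp
  then have "i x = 0"
    using assms(3) by simp
  then have "i x = i \<one>\<^bsub>K\<^esub>"
    by simp
  with i assms(2) show ?thesis
    unfolding iso_def bij_betw_def using inj_onD K.one_closed by fastforce
qed

text \<open>In coordinates: a nonzero integer entry of \<open>x\<close> is not a multiple of an
  integer exceeding its absolute value.\<close>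

lemma free_abelian_not_divisible:
  fixes K :: "('a, 'm) monoid_scheme"
  assumes "free_abelian K" "x \<in> carrier K" "x \<noteq> \<one>\<^bsub>K\<^esub>"
  obtains k :: nat where "0 < k" "\<And>y. y \<in> carrier K \<Longrightarrow> y [^]\<^bsub>K\<^esub> k \<noteq> x"
proof -
  obtain I :: "'a set" and i where K: "comm_group K" and i: "i \<in> iso K (free_Abelian_group I)"
    using assms(1) unfolding free_abelian_def is_iso_def by blast
  interpret K: comm_group K by (fact K)
  interpret i: group_hom K "free_Abelian_group I" i
    using i by (auto simp: group_hom_def group_hom_axioms_def iso_def)
  have bij: "bij_betw i (carrier K) (carrier (free_Abelian_group I))"
    using i by (simp add: iso_def)
  have "i x \<noteq> i \<one>\<^bsub>K\<^esub>"
    using inj_on_contraD[OF bij_betw_imp_inj_on[OF bij] assms(3,2)] by simp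
  then have "i x \<noteq> 0"
    by simp
  then obtain j where j: "Poly_Mapping.lookup (i x) j \<noteq> 0"
    using poly_mapping_eqI[of "i x" 0] by auto
  define k where "k = nat \<bar>Poly_Mapping.lookup (i x) j\<bar> + 1"
  have "y [^]\<^bsub>K\<^esub> k \<noteq> x" if y: "y \<in> carrier K" for y
  proof
    assume "y [^]\<^bsub>K\<^esub> k = x"
    then have "i x = frag_cmul (int k) (i y)"
      using i.hom_nat_pow[OF y, of k] i.hom_closed[OF y] by simp
    then have "int k dvd Poly_Mapping.lookup (i x) j"
      by simp
    with j have "int k \<le> \<bar>Poly_Mapping.lookup (i x) j\<bar>"
      using dvd_imp_le_int[of "Poly_Mapping.lookup (i x) j" "int k"] by simp
    then show False
      by (simp add: k_def)
  qed
  then show thesis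
    using that[of k] by (simp add: k_def)
qed

lemma aleph1_free_abelian_subgroup:
  assumes "aleph1_free_abelian H" "X \<subseteq> carrier H" "countable X"
  shows "free_abelian (subgroup_generated H (generate H X))"
    and "carrier (subgroup_generated H (generate H X)) = generate H X"
proof -
  interpret comm_group H
    using assms(1) by (simp add: aleph1_free_abelian_def)
  have "subgroup (generate H X) H"
    using assms(2) by (rule generate_is_subgroup)
  then show "free_abelian (subgroup_generated H (generate H X))"
    and "carrier (subgroup_generated H (generate H X)) = generate H X"
    using assms countable_generate unfolding aleph1_free_abelian_def
    by (auto simp: subgroup.carrier_subgroup_generated_subgroup)
qed

lemma aleph1_free_abelian_torsion_free:
  assumes "aleph1_free_abelian H" "x \<in> carrier H" "0 < k" "x [^]\<^bsub>H\<^esub> (k::nat) = \<one>\<^bsub>H\<^esub>"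
  shows "x = \<one>\<^bsub>H\<^esub>"
proof -
  have "x \<in> generate H {x}"
    by (simp add: generate.incl)
  then show ?thesis
    using free_abelian_torsion_free[of "subgroup_generated H (generate H {x})" x k]
      aleph1_free_abelian_subgroup[of H "{x}"] assms by (simp add: pow_subgroup_generated)
qed

text \<open>\<open>H\<close> may fail to be free, so \<open>k\<close> cannot be read off from a
  basis of \<open>H\<close>. But \<open>x\<close> together with one \<open>k\<close>-th root for
  each \<open>k\<close> would generate a countable, hence free, subgroup in which \<open>x\<close>
  is divisible by every positive \<open>k\<close>.\<close>

lemma aleph1_free_abelian_not_divisible:
  assumes H: "aleph1_free_abelian H" and x: "x \<in> carrier H" "x \<noteq> \<one>\<^bsub>H\<^esub>"
  shows "\<exists>k::nat. 0 < k \<and> (\<forall>y \<in> carrier H. y [^]\<^bsub>H\<^esub> k \<noteq> x)"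
proof (rule ccontr)
  assume "\<not> ?thesis"
  then obtain y where y: "\<And>k::nat. 0 < k \<Longrightarrow> y k \<in> carrier H \<and> y k [^]\<^bsub>H\<^esub> k = x"
    by metis
  define X where "X = insert x (y ` {0<..})"
  let ?S = "generate H X"
  have X: "X \<subseteq> carrier H" "countable X"
    using y x by (auto simp: X_def)
  have "x \<in> ?S"
    by (simp add: X_def generate.incl)
  with x aleph1_free_abelian_subgroup[OF H X] obtain k :: nat
    where k: "0 < k" "\<And>z. z \<in> ?S \<Longrightarrow> z [^]\<^bsub>H\<^esub> k \<noteq> x"
    using free_abelian_not_divisible[of "subgroup_generated H ?S" x]
    by (auto simp: pow_subgroup_generated)
  have "y k \<in> ?S"
    using k(1) by (simp add: X_def generate.incl)
  with k y show False
    by blast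
qed

section \<open>Solving systems inside a countable pure subgroup\<close>

text \<open>A solution has countably many entries, so \<open>M\<close> is a direct summand of the
  subgroup they generate together with \<open>M\<close>. The projection onto \<open>M\<close> fixes
  every \<open>h n\<close> and carries the solution along.\<close>

lemma (in comm_group) aleph1_pure_retract_system:
  fixes k :: "nat \<Rightarrow> nat"
  assumes M: "aleph1_pure G M" and h: "\<And>n. h n \<in> M"
    and x: "\<And>n. x n \<in> carrier G" "\<And>n. x n = h n \<otimes> x (Suc n) [^] k n"
  obtains y where "\<And>n. y n \<in> M" "\<And>n. y n = h n \<otimes> y (Suc n) [^] k n"
proof -
  have "direct_summand G M (generate G (M \<union> range x))"
    using M x(1) unfolding aleph1_pure_def
    by (metis countableI_type countable_image image_subset_iff)
  then obtain C where sM: "subgroup M G" and sC: "subgroup C G" and int: "M \<inter> C = {\<one>}"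
    and sum: "M <#> C = generate G (M \<union> range x)"
    by (auto simp: direct_summand_def)
  have cM: "a \<in> carrier G" if "a \<in> M" for a
    using that sM subgroup.mem_carrier by fast
  have cC: "a \<in> carrier G" if "a \<in> C" for a
    using that sC subgroup.mem_carrier by fast
  \<comment> \<open>The projection is well defined: \<open>M\<close> and \<open>C\<close> meet
    trivially, so a product determines its \<open>M\<close>-part.\<close>
  have uniq: "a = b" if "a \<in> M" "b \<in> M" "c \<in> C" "d \<in> C" "a \<otimes> c = b \<otimes> d" for a b c d
  proof -
    have "inv b \<otimes> a \<otimes> c = inv b \<otimes> (b \<otimes> d)"
      using that by (simp add: m_assoc cM cC)
    also have "\<dots> = d"
      using that by (simp add: m_assoc[symmetric] cM cC)
    finally have "inv b \<otimes> a = d \<otimes> inv c"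
      using that by (intro inv_solve_right[THEN iffD2]) (auto simp: cM cC)
    moreover have "inv b \<otimes> a \<in> M" "d \<otimes> inv c \<in> C"
      using that sM sC by (auto intro!: subgroup.m_closed subgroup.m_inv_closed)
    ultimately have "inv b \<otimes> a = \<one>"
      using int by auto
    then show "a = b"
      using that by (metis cM inv_closed inv_inv inv_equality)
  qed
  have "\<exists>a c. a \<in> M \<and> c \<in> C \<and> x n = a \<otimes> c" for n
  proof -
    have "x n \<in> M <#> C"
      unfolding sum by (rule generate.incl) simp
    then show ?thesis
      by (auto simp: set_mult_def)
  qed
  then obtain y c where yc: "\<And>n. y n \<in> M" "\<And>n. c n \<in> C" "\<And>n. x n = y n \<otimes> c n"
    by metis
  \<comment> \<open>Both sides are the \<open>M\<close>-part of \<open>x n\<close>: one by choice of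
    \<open>y n\<close>, the other by decomposing \<open>x (Suc n)\<close> and distributing the
    power.\<close>
  have "y n = h n \<otimes> y (Suc n) [^] k n" for n
  proof (rule uniq[where c = "c n" and d = "c (Suc n) [^] k n"])
    have pM: "y (Suc n) [^] k n \<in> M" and pC: "c (Suc n) [^] k n \<in> C"
      using yc sM sC by (metis int_pow_int subgroup_int_pow_closed)+
    then show "h n \<otimes> y (Suc n) [^] k n \<in> M" "c (Suc n) [^] k n \<in> C"
      using h sM by (auto intro: subgroup.m_closed)
    have "y n \<otimes> c n = h n \<otimes> (y (Suc n) \<otimes> c (Suc n)) [^] k n"
      using x(2)[of n] by (simp only: yc(3))
    also have "\<dots> = h n \<otimes> y (Suc n) [^] k n \<otimes> c (Suc n) [^] k n"
      using yc(1,2) h by (simp add: nat_pow_distrib m_assoc cM cC)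
    finally show "y n \<otimes> c n = h n \<otimes> y (Suc n) [^] k n \<otimes> c (Suc n) [^] k n" .
  qed (use yc in auto)
  with yc(1) show thesis
    by (rule that)
qed

text \<open>All three slenderness claims end in this contradiction. It speaks of elements of
  \<open>H\<close> alone, so it also applies to values of a homomorphism on infinite words, without
  passing through group laws for \<open>hawaiian\<close>.\<close>

lemma strongly_aleph1_free_no_systems:
  fixes k :: "nat \<Rightarrow> nat"
  assumes H: "strongly_aleph1_free_abelian H"
    and h: "\<And>n. h n \<in> carrier H" and k: "\<And>n. 0 < k n"
    and ndvd: "\<And>n y. y \<in> carrier H \<Longrightarrow> y [^]\<^bsub>H\<^esub> k n \<noteq> h n"
    and sol: "\<And>S. \<exists>x. \<forall>n. x n \<in> carrier H \<and>
      x n = (if n \<in> S then h n else \<one>\<^bsub>H\<^esub>) \<otimes>\<^bsub>H\<^esub> x (Suc n) [^]\<^bsub>H\<^esub> k n"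
  shows False
proof -
  have H1: "aleph1_free_abelian H"
    using H by (simp add: strongly_aleph1_free_abelian_def)
  then interpret comm_group H
    by (simp add: aleph1_free_abelian_def)
  obtain M where M: "range h \<subseteq> M" "aleph1_pure H M" "countably_generated_subgroup H M"
    using H h unfolding strongly_aleph1_free_abelian_def
    by (metis countableI_type countable_image image_subset_iff)
  have cM: "countable M"
    using M(3) countable_generate unfolding countably_generated_subgroup_def by metis
  have sM: "subgroup M H"
    using M(2) by (simp add: aleph1_pure_def)
  define e where "e S n = (if n \<in> S then h n else \<one>\<^bsub>H\<^esub>)" for S n
  have e: "e S n \<in> M" for S n
    using M(1) sM by (auto simp: e_def subgroup.one_closed)
  have "\<exists>y. \<forall>n. y n \<in> M \<and> y n = e S n \<otimes>\<^bsub>H\<^esub> y (Suc n) [^]\<^bsub>H\<^esub> k n" for S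
  proof -
    obtain x where x: "\<And>n. x n \<in> carrier H" "\<And>n. x n = e S n \<otimes>\<^bsub>H\<^esub> x (Suc n) [^]\<^bsub>H\<^esub> k n"
      using sol[of S] unfolding e_def by blast
    show ?thesis
      by (rule aleph1_pure_retract_system[where h = "e S" and x = x and k = k, OF M(2) e x]) blast
  qed
  \<comment> \<open>A solution in \<open>M\<close> is fixed for all \<open>S\<close> simultaneously,
    so that the values at 0 define a map from sets to \<open>M\<close>.\<close>
  then have "\<exists>y. \<forall>S n. y S n \<in> M \<and> y S n = e S n \<otimes>\<^bsub>H\<^esub> y S (Suc n) [^]\<^bsub>H\<^esub> k n"
    by (intro choice allI)
  then obtain y where yM: "\<And>S n. y S n \<in> M"
    and y: "\<And>S n. y S n = e S n \<otimes>\<^bsub>H\<^esub> y S (Suc n) [^]\<^bsub>H\<^esub> k n"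
    by blast
  have yH [simp]: "y S n \<in> carrier H" for S n
    using yM sM subgroup.mem_carrier by fast
  have "\<not> inj (\<lambda>S. y S 0)"
    using uncountable_UNIV_nat_set countable_subset[OF _ cM, of "range (\<lambda>S. y S 0)"] yM
    by (auto dest: countable_image_inj_on)
  then obtain S S' where S: "S \<noteq> S'" "y S 0 = y S' 0"
    by (auto simp: inj_on_def)
  define n where "n = (LEAST n. n \<in> S \<longleftrightarrow> n \<notin> S')"
  have n: "n \<in> S \<longleftrightarrow> n \<notin> S'"
    unfolding n_def by (rule LeastI_ex) (use S in blast)
  have below: "i \<in> S \<longleftrightarrow> i \<in> S'" if "i < n" for i
    using not_less_Least that unfolding n_def by blast
  have "y S i = y S' i" if "i \<le> n" for i
    using that
  proof (induction i)
    case (Suc i)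
    have "e S i = e S' i"
      using below[of i] Suc.prems by (simp add: e_def)
    then have "y S (Suc i) [^]\<^bsub>H\<^esub> k i = y S' (Suc i) [^]\<^bsub>H\<^esub> k i"
      using Suc y[of S i] y[of S' i] h by (simp add: e_def split: if_splits)
    \<comment> \<open>The quotient of the two values is torsion, hence trivial.\<close>
    then have "(y S (Suc i) \<otimes>\<^bsub>H\<^esub> inv\<^bsub>H\<^esub> y S' (Suc i)) [^]\<^bsub>H\<^esub> k i = \<one>\<^bsub>H\<^esub>"
      by (simp add: nat_pow_distrib nat_pow_inv)
    then have "y S (Suc i) \<otimes>\<^bsub>H\<^esub> inv\<^bsub>H\<^esub> y S' (Suc i) = \<one>\<^bsub>H\<^esub>"
      using aleph1_free_abelian_torsion_free[OF H1 _ k] by simp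
    then show ?case
      by (metis inv_equality inv_inv inv_closed yH)
  qed (use S in simp)
  then have eq: "e S n \<otimes>\<^bsub>H\<^esub> y S (Suc n) [^]\<^bsub>H\<^esub> k n = e S' n \<otimes>\<^bsub>H\<^esub> y S' (Suc n) [^]\<^bsub>H\<^esub> k n"
    using y[of S n] y[of S' n] by simp
  \<comment> \<open>Stated for arbitrary \<open>a\<close> and \<open>b\<close> because either of
    \<open>S\<close> and \<open>S'\<close> may be the one that contains \<open>n\<close>.\<close>
  have contra: False if eq: "h n \<otimes>\<^bsub>H\<^esub> a [^]\<^bsub>H\<^esub> k n = b [^]\<^bsub>H\<^esub> k n" "a \<in> carrier H" "b \<in> carrier H" for a b
  proof -
    have "h n = b [^]\<^bsub>H\<^esub> k n \<otimes>\<^bsub>H\<^esub> inv\<^bsub>H\<^esub> (a [^]\<^bsub>H\<^esub> k n)"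
      using eq h by (metis inv_solve_right nat_pow_closed)
    also have "\<dots> = (b \<otimes>\<^bsub>H\<^esub> inv\<^bsub>H\<^esub> a) [^]\<^bsub>H\<^esub> k n"
      using eq by (simp add: nat_pow_distrib nat_pow_inv)
    finally show False
      using ndvd[of "b \<otimes>\<^bsub>H\<^esub> inv\<^bsub>H\<^esub> a" n] eq by simp
  qed
  show False
    using contra[of "y S (Suc n)" "y S' (Suc n)"] contra[of "y S' (Suc n)" "y S (Suc n)"] eq n
    by (auto simp: e_def)
qed

section \<open>Topological groups\<close>

text \<open>The composition of \<open>F n\<close>, ..., \<open>F (n + j - 1)\<close> with
  \<open>F n\<close> outermost: the entry at \<open>n\<close> of the solution of
  \<open>x i = F i (x (Suc i))\<close> that is truncated by \<open>x (n + j) = z\<close>.\<close>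

primrec telescope :: "(nat \<Rightarrow> 'a \<Rightarrow> 'a) \<Rightarrow> nat \<Rightarrow> nat \<Rightarrow> 'a \<Rightarrow> 'a" where
  "telescope F n 0 z = z"
| "telescope F n (Suc j) z = F n (telescope F (Suc n) j z)"

text \<open>Exposes the innermost map, so that truncations of consecutive lengths become values of
  one map at two points.\<close>

lemma telescope_Suc_right: "telescope F n (Suc j) z = telescope F n j (F (n + j) z)"
  by (induction j arbitrary: n) simp_all

lemma telescope_mem:
  assumes "\<And>n. F n ` C (Suc n) \<subseteq> C n" "z \<in> C (n + j)"
  shows "telescope F n j z \<in> C n"
  using assms(2)
proof (induction j arbitrary: n)
  case (Suc j)
  then have "telescope F (Suc n) j z \<in> C (Suc n)"
    by simp
  then show ?case
    using assms(1)[of n] by auto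
qed simp

text \<open>In the compact product of the sets \<open>C i\<close>, the sequences satisfying the
  first \<open>n\<close> equations form a decreasing chain of nonempty closed sets; a common point
  satisfies all equations.\<close>

lemma compact_inverse_sequence:
  assumes haus: "Hausdorff_space T" and C: "\<And>n. compactin T (C n)" "\<And>n. C n \<noteq> {}"
    and F: "\<And>n. continuous_map T T (F n)" "\<And>n. F n ` C (Suc n) \<subseteq> C n"
  shows "\<exists>x. \<forall>n. x n \<in> C n \<and> x n = F n (x (Suc n))"
proof -
  define X where "X = subtopology (product_topology (\<lambda>_::nat. T) UNIV) (Pi\<^sub>E UNIV C)"
  define E where "E n = {x \<in> Pi\<^sub>E UNIV C. \<forall>i<n. x i = F i (x (Suc i))}" for n
  have "compactin (product_topology (\<lambda>_. T) UNIV) (Pi\<^sub>E UNIV C)"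
    using C(1) by (simp add: compactin_PiE)
  then have X: "compact_space X" "topspace X = Pi\<^sub>E UNIV C"
    unfolding X_def by (auto simp: compactin_subspace topspace_subtopology_subset)
  have coord: "continuous_map X T (\<lambda>x. x i)" for i
    unfolding X_def
    by (intro continuous_map_from_subtopology continuous_map_product_projection) simp
  have "closedin X (E n)" for n
  proof (induction n)
    case 0
    have "E 0 = topspace X"
      by (simp add: E_def X(2))
    then show ?case
      by (simp only: closedin_topspace)
  next
    case (Suc n)
    have "continuous_map X T (\<lambda>x. F n (x (Suc n)))"
      using continuous_map_compose[OF coord F(1)] by (simp add: comp_def)
    \<comment> \<open>The set where two continuous maps into a Hausdorff space agree is
      closed.\<close>
    then have "closedin X {x \<in> topspace X. x n = F n (x (Suc n))}"
      by (intro closedin_continuous_maps_eq[OF haus coord])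
    with Suc have "closedin X (E n \<inter> {x \<in> topspace X. x n = F n (x (Suc n))})"
      by (rule closedin_Int)
    also have "E n \<inter> {x \<in> topspace X. x n = F n (x (Suc n))} = E (Suc n)"
      by (auto simp: E_def X(2) less_Suc_eq)
    finally show ?case .
  qed
  moreover have "E n \<noteq> {}" for n
  proof -
    have "\<forall>i. \<exists>c. c \<in> C i"
      using C(2) by blast
    then obtain c where c: "\<And>i. c i \<in> C i"
      using choice[of "\<lambda>i c. c \<in> C i"] by blast
    \<comment> \<open>Truncated subtraction makes this \<open>c i\<close> for
      \<open>i \<ge> n\<close>; for smaller \<open>i\<close> the point \<open>c n\<close> is pulled
      back through the maps. The index \<open>i + (n - i)\<close> has the form that
      \<open>telescope_mem\<close> expects.\<close>
    define x where "x i = telescope F i (n - i) (c (i + (n - i)))" for i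
    have "x i \<in> C i" for i
      unfolding x_def by (intro telescope_mem F(2) c)
    moreover have "x i = F i (x (Suc i))" if "i < n" for i
      using that by (simp add: x_def Suc_diff_Suc flip: telescope.simps(2))
    ultimately have "x \<in> E n"
      by (simp add: E_def PiE_UNIV_domain)
    then show ?thesis
      by blast
  qed
  moreover have "decseq E"
    by (auto simp: decseq_def E_def)
  ultimately have "(\<Inter>n. E n) \<noteq> {}"
    by (intro compact_space_imp_nest[OF X(1)])
  then obtain x where x: "\<And>n. x \<in> E n"
    by blast
  have "x n \<in> C n \<and> x n = F n (x (Suc n))" for n
    using x[of "Suc n"] unfolding E_def PiE_iff by blast
  then show ?thesis
    by blast
qed

lemma (in Metric_space) MCauchy_geometric:
  assumes s: "\<And>n. s n \<in> M" "\<And>n. d (s n) (s (Suc n)) < (1/2) ^ n"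
  shows "MCauchy s"
  unfolding MCauchy_def
proof (intro conjI allI impI)
  \<comment> \<open>Keeping the subtracted tail of the geometric series is what lets the induction
    close.\<close>
  have far: "d (s n) (s (n + j)) \<le> 2 * (1/2) ^ n - 2 * (1/2) ^ (n + j)" for n j
  proof (induction j)
    case (Suc j)
    have "d (s n) (s (n + Suc j)) \<le> d (s n) (s (n + j)) + d (s (n + j)) (s (Suc (n + j)))"
      using triangle[OF s(1) s(1) s(1)] by simp
    with Suc s(2)[of "n + j"] show ?case
      by simp
  qed (simp add: s(1))
  fix \<epsilon> :: real assume "0 < \<epsilon>"
  then obtain N where N: "(1/2) ^ N < \<epsilon> / 4"
    using real_arch_pow_inv[of "\<epsilon> / 4" "1/2"] by auto
  have near: "d (s N) (s n) < \<epsilon> / 2" if "N \<le> n" for n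
  proof -
    have "d (s N) (s n) \<le> 2 * (1/2) ^ N - 2 * (1/2) ^ n"
      using far[of N "n - N"] that by simp
    also have "\<dots> < \<epsilon> / 2"
      using N zero_less_power[of "1/2::real" n] by linarith
    finally show ?thesis .
  qed
  have "d (s n) (s n') < \<epsilon>" if "N \<le> n" "N \<le> n'" for n n'
    using triangle'[OF s(1)[of n] s(1)[of N] s(1)[of n']] near[OF that(1)] near[OF that(2)]
      triangle[OF s(1)[of n] s(1)[of N] s(1)[of n']] commute[of "s n" "s N"] by linarith
  then show "\<exists>N. \<forall>n n'. N \<le> n \<longrightarrow> N \<le> n' \<longrightarrow> d (s n) (s n') < \<epsilon>"
    by blast
qed (use s(1) in blast)

text \<open>For each \<open>n\<close> the truncated solutions converge as \<open>j\<close> grows.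
  The truncation of length \<open>j + 1\<close> at \<open>n\<close> is \<open>F n\<close> of the one
  of length \<open>j\<close> at \<open>Suc n\<close>, and continuity passes this relation to the
  limits.\<close>

lemma (in Metric_space) mcomplete_inverse_sequence:
  assumes comp: mcomplete and e: "e \<in> M"
    and F: "\<And>n. continuous_map mtopology mtopology (F n)"
    and near: "\<And>n j. d (telescope F n j e) (telescope F n (Suc j) e) < (1/2) ^ (n + j)"
  shows "\<exists>x. \<forall>n. x n \<in> M \<and> x n = F n (x (Suc n))"
proof -
  have tM: "telescope F n j e \<in> M" for n j
    by (rule telescope_mem[where C = "\<lambda>_. M"])
      (use e continuous_map_image_subset_topspace[OF F] in auto)
  have "MCauchy (\<lambda>j. telescope F n j e)" for n
  proof (rule MCauchy_geometric)
    show "d (telescope F n j e) (telescope F n (Suc j) e) < (1/2) ^ j" for j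
      by (rule less_le_trans[OF near]) (simp add: power_decreasing)
  qed (rule tM)
  then have "\<exists>x. \<forall>n. limitin mtopology (\<lambda>j. telescope F n j e) (x n) sequentially"
    using comp unfolding mcomplete_def by (intro choice allI) blast
  then obtain x where x: "\<And>n. limitin mtopology (\<lambda>j. telescope F n j e) (x n) sequentially"
    by blast
  have "x n = F n (x (Suc n))" for n
  proof (rule limitin_metric_unique)
    show "limitin mtopology (\<lambda>j. telescope F n (j + 1) e) (x n) sequentially"
      by (rule limitin_sequentially_offset[OF x])
    show "limitin mtopology (\<lambda>j. telescope F n (j + 1) e) (F n (x (Suc n))) sequentially"
      using continuous_map_limit[OF F x] by (simp add: comp_def)
  qed simp
  moreover have "x n \<in> M" for n
    using limitin_topspace[OF x] by simp
  ultimately show ?thesis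
    by blast
qed

section \<open>Homomorphisms from topological groups\<close>

lemma topological_group_mult_pow:
  assumes G: "topological_group G T" and g: "g \<in> carrier G"
  shows "continuous_map T T (\<lambda>z. g \<otimes>\<^bsub>G\<^esub> z [^]\<^bsub>G\<^esub> (k::nat))"
proof -
  have mult: "continuous_map T T (\<lambda>z. u z \<otimes>\<^bsub>G\<^esub> v z)"
    if "continuous_map T T u" "continuous_map T T v" for u v
    using continuous_map_compose[OF continuous_map_pairedI[OF that],
        of T "\<lambda>(x, y). x \<otimes>\<^bsub>G\<^esub> y"] G
    by (simp add: topological_group_def comp_def)
  have top: "topspace T = carrier G" and "group G"
    using G by (auto simp: topological_group_def)
  then interpret group G
    by simp
  have "continuous_map T T (\<lambda>z. z [^]\<^bsub>G\<^esub> k)"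
  proof (induction k)
    case (Suc k)
    then show ?case
      using mult[of "\<lambda>z. z [^]\<^bsub>G\<^esub> k" "\<lambda>z. z"] by simp
  qed (simp add: top)
  then show ?thesis
    using g by (intro mult) (simp_all add: top)
qed

text \<open>A neighbourhood of the identity inside the kernel can be translated to every point of
  the kernel.\<close>

lemma topological_group_open_kernel:
  assumes G: "topological_group G T" and H: "group H" and f: "f \<in> hom G H"
    and U: "openin T U" "\<one>\<^bsub>G\<^esub> \<in> U" "U \<subseteq> kernel G H f"
  shows "openin T (kernel G H f)"
proof (subst openin_subopen, intro ballI)
  have top: "topspace T = carrier G" and "group G"
    using G by (auto simp: topological_group_def)
  then interpret group_hom G H f
    using H f by (simp add: group_hom_def group_hom_axioms_def)
  fix x assume "x \<in> kernel G H f"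
  then have x: "x \<in> carrier G" "f x = \<one>\<^bsub>H\<^esub>"
    by (auto simp: kernel_def)
  \<comment> \<open>The exponent 1 makes left translation an instance of
    \<open>topological_group_mult_pow\<close>.\<close>
  let ?V = "{y \<in> topspace T. inv\<^bsub>G\<^esub> x \<otimes>\<^bsub>G\<^esub> y [^]\<^bsub>G\<^esub> (1::nat) \<in> U}"
  have "openin T ?V"
    using x(1) by (intro openin_continuous_map_preimage[OF topological_group_mult_pow[OF G] U(1)]) simp
  moreover have "x \<in> ?V"
    using x U(2) by (simp add: top)
  moreover have "?V \<subseteq> kernel G H f"
  proof
    fix y assume y: "y \<in> ?V"
    then have "f (inv\<^bsub>G\<^esub> x \<otimes>\<^bsub>G\<^esub> y) = \<one>\<^bsub>H\<^esub>" "y \<in> carrier G"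
      using U(3) by (auto simp: kernel_def top)
    then show "y \<in> kernel G H f"
      using x by (simp add: kernel_def)
  qed
  ultimately show "\<exists>V. openin T V \<and> x \<in> V \<and> V \<subseteq> kernel G H f"
    by blast
qed

text \<open>Supplies the next pair of \<open>g\<close> and \<open>k\<close> in both recursive
  constructions: \<open>U\<close> prescribes how small \<open>g\<close> has to be, and
  \<open>k\<close> then comes from indivisibility of \<open>f g\<close>.\<close>

lemma nonopen_kernel_indivisible:
  assumes H: "aleph1_free_abelian H" and G: "topological_group G T" and f: "f \<in> hom G H"
    and ker: "\<not> openin T (kernel G H f)" and U: "openin T U" "\<one>\<^bsub>G\<^esub> \<in> U"
  shows "\<exists>g (k::nat). g \<in> U \<and> 0 < k \<and> (\<forall>y\<in>carrier H. y [^]\<^bsub>H\<^esub> k \<noteq> f g)"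
proof -
  have "group H"
    using H by (simp add: aleph1_free_abelian_def comm_group_def)
  then have "\<not> U \<subseteq> kernel G H f"
    using topological_group_open_kernel[OF G _ f U] ker by blast
  then obtain g where g: "g \<in> U" "g \<notin> kernel G H f"
    by blast
  have "g \<in> carrier G"
    using g(1) openin_subset[OF U(1)] G by (auto simp: topological_group_def)
  then have "f g \<in> carrier H" "f g \<noteq> \<one>\<^bsub>H\<^esub>"
    using g(2) f by (auto simp: kernel_def hom_def)
  from aleph1_free_abelian_not_divisible[OF H this] g(1) show ?thesis
    by blast
qed

lemma strongly_aleph1_free_no_hom_systems:
  fixes k :: "nat \<Rightarrow> nat"
  assumes H: "strongly_aleph1_free_abelian H" and G: "group G" and f: "f \<in> hom G H"
    and g: "\<And>n. g n \<in> carrier G" and k: "\<And>n. 0 < k n"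
    and ndvd: "\<And>n y. y \<in> carrier H \<Longrightarrow> y [^]\<^bsub>H\<^esub> k n \<noteq> f (g n)"
    and sol: "\<And>S. \<exists>x. \<forall>n. x n \<in> carrier G \<and>
      x n = (if n \<in> S then g n else \<one>\<^bsub>G\<^esub>) \<otimes>\<^bsub>G\<^esub> x (Suc n) [^]\<^bsub>G\<^esub> k n"
  shows False
proof -
  have "group H"
    using H by (simp add: strongly_aleph1_free_abelian_def aleph1_free_abelian_def comm_group_def)
  then interpret group_hom G H f
    using G f by (simp add: group_hom_def group_hom_axioms_def)
  show False
  proof (rule strongly_aleph1_free_no_systems[where h = "\<lambda>n. f (g n)", OF H _ k ndvd])
    fix S
    obtain x where x: "\<And>n. x n \<in> carrier G"
        "\<And>n. x n = (if n \<in> S then g n else \<one>\<^bsub>G\<^esub>) \<otimes>\<^bsub>G\<^esub> x (Suc n) [^]\<^bsub>G\<^esub> k n"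
      using sol[of S] by blast
    have "f (x n) = (if n \<in> S then f (g n) else \<one>\<^bsub>H\<^esub>) \<otimes>\<^bsub>H\<^esub> f (x (Suc n)) [^]\<^bsub>H\<^esub> k n" for n
    proof -
      have "f (x n) = f ((if n \<in> S then g n else \<one>\<^bsub>G\<^esub>) \<otimes>\<^bsub>G\<^esub> x (Suc n) [^]\<^bsub>G\<^esub> k n)"
        using x(2)[of n] by (rule arg_cong)
      also have "\<dots> = (if n \<in> S then f (g n) else \<one>\<^bsub>H\<^esub>) \<otimes>\<^bsub>H\<^esub> f (x (Suc n)) [^]\<^bsub>H\<^esub> k n"
        using x(1) g by (simp add: hom_nat_pow)
      finally show ?thesis .
    qed
    then show "\<exists>x. \<forall>n. x n \<in> carrier H \<and> x n =
        (if n \<in> S then f (g n) else \<one>\<^bsub>H\<^esub>) \<otimes>\<^bsub>H\<^esub> x (Suc n) [^]\<^bsub>H\<^esub> k n"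
      using hom_closed[OF x(1)] by (intro exI[of _ "\<lambda>n. f (x n)"] allI conjI)
  qed (use g in simp)
qed

section \<open>Locally compact Hausdorff groups\<close>

lemma strongly_aleph1_free_lcH_slender:
  fixes H :: "('a, 'm) monoid_scheme"
  assumes H: "strongly_aleph1_free_abelian H"
  shows "lcH_slender H TYPE('g \<times> 'n)"
  unfolding lcH_slender_def
proof (intro allI impI, elim conjE, rule ccontr)
  fix G :: "('g, 'n) monoid_scheme" and T f
  assume G: "topological_group G T" and lc: "locally_compact_space T" and haus: "Hausdorff_space T"
    and f: "f \<in> hom G H" and ker: "\<not> openin T (kernel G H f)"
  have H1: "aleph1_free_abelian H"
    using H by (simp add: strongly_aleph1_free_abelian_def)
  have top: "topspace T = carrier G" and "group G"
    using G by (auto simp: topological_group_def)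
  then interpret group G
    by simp
  define good where "good = (\<lambda>(V, C, g, k::nat). openin T V \<and> compactin T C \<and> \<one>\<^bsub>G\<^esub> \<in> V \<and> V \<subseteq> C
    \<and> g \<in> V \<and> 0 < k \<and> (\<forall>y\<in>carrier H. y [^]\<^bsub>H\<^esub> k \<noteq> f g))"
  \<comment> \<open>Both candidates for the map at one index, with and without \<open>g\<close>,
    send the next compact set into the current one, so a single sequence serves every
    \<open>S\<close>. The factor 1 is the value of the conditional for indices outside
    \<open>S\<close>.\<close>
  define fits where "fits = (\<lambda>(V :: 'g set, C, g, k) (V' :: 'g set, C', g' :: 'g, k' :: nat).
    \<forall>z\<in>C'. g \<otimes>\<^bsub>G\<^esub> z [^]\<^bsub>G\<^esub> (k::nat) \<in> C \<and> \<one>\<^bsub>G\<^esub> \<otimes>\<^bsub>G\<^esub> z [^]\<^bsub>G\<^esub> k \<in> C)"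
  have next_good: "\<exists>V C g k. good (V, C, g, k) \<and> C \<subseteq> W" if W: "openin T W" "\<one>\<^bsub>G\<^esub> \<in> W" for W
  proof -
    \<comment> \<open>In a locally compact Hausdorff space, compact neighbourhoods can be taken
      inside any given neighbourhood.\<close>
    have "neighbourhood_base_of (compactin T) T"
      using lc haus locally_compact_space_neighbourhood_base by blast
    then obtain V C where VC: "openin T V" "compactin T C" "\<one>\<^bsub>G\<^esub> \<in> V" "V \<subseteq> C" "C \<subseteq> W"
      using W unfolding neighbourhood_base_of by meson
    obtain g k where "g \<in> V" "0 < (k::nat)" "\<forall>y\<in>carrier H. y [^]\<^bsub>H\<^esub> k \<noteq> f g"
      using nonopen_kernel_indivisible[OF H1 G f ker VC(1,3)] by blast
    with VC have "good (V, C, g, k) \<and> C \<subseteq> W"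
      by (simp add: good_def)
    then show ?thesis
      by blast
  qed
  have "\<exists>s. \<forall>n::nat. good (s n) \<and> fits (s n) (s (Suc n))"
  proof (rule dependent_nat_choice)
    have "\<one>\<^bsub>G\<^esub> \<in> topspace T"
      by (simp add: top)
    from next_good[OF openin_topspace this] show "\<exists>x. good x"
      by blast
  next
    fix s :: "'g set \<times> 'g set \<times> 'g \<times> nat" and n :: nat
    obtain V C g k where s: "s = (V, C, g, k)"
      by (cases s)
    assume "good s"
    then have VC: "openin T V" "\<one>\<^bsub>G\<^esub> \<in> V" "V \<subseteq> C" "g \<in> V"
      by (auto simp: good_def s)
    have g: "g \<in> carrier G"
      using VC(1,4) openin_subset top by blast
    \<comment> \<open>The identity lies in both preimages, since the maps send it to
      \<open>g\<close> and to 1. This is why \<open>good\<close> places \<open>g\<close> in the open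
      set \<open>V\<close>.\<close>
    let ?W = "{z \<in> topspace T. g \<otimes>\<^bsub>G\<^esub> z [^]\<^bsub>G\<^esub> k \<in> V} \<inter> {z \<in> topspace T. \<one>\<^bsub>G\<^esub> \<otimes>\<^bsub>G\<^esub> z [^]\<^bsub>G\<^esub> k \<in> V}"
    have "openin T ?W"
      using g by (intro openin_Int openin_continuous_map_preimage[OF topological_group_mult_pow[OF G] VC(1)]) auto
    moreover have "\<one>\<^bsub>G\<^esub> \<in> ?W"
      using VC g by (simp add: top)
    ultimately obtain V' C' g' k' where good: "good (V', C', g', k')" and C': "C' \<subseteq> ?W"
      using next_good[of ?W] by blast
    have "fits s (V', C', g', k')"
      using C' VC(3) unfolding fits_def s by auto
    with good show "\<exists>y. good y \<and> fits s y"
      by blast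
  qed
  then obtain s where s: "\<And>n::nat. good (s n)" "\<And>n. fits (s n) (s (Suc n))"
    by blast
  define C where "C n = fst (snd (s n))" for n
  define g where "g n = fst (snd (snd (s n)))" for n
  define k where "k n = snd (snd (snd (s n)))" for n
  have sn: "s n = (fst (s n), C n, g n, k n)" for n
    by (simp add: C_def g_def k_def)
  have good: "openin T (fst (s n))" "compactin T (C n)" "\<one>\<^bsub>G\<^esub> \<in> C n" "g n \<in> fst (s n)" "0 < k n"
      "\<forall>y\<in>carrier H. y [^]\<^bsub>H\<^esub> k n \<noteq> f (g n)" for n
    using s(1)[of n] unfolding good_def by (subst (asm) sn, auto)+
  have fits: "g n \<otimes>\<^bsub>G\<^esub> z [^]\<^bsub>G\<^esub> k n \<in> C n \<and> \<one>\<^bsub>G\<^esub> \<otimes>\<^bsub>G\<^esub> z [^]\<^bsub>G\<^esub> k n \<in> C n"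
    if "z \<in> C (Suc n)" for n z
    using s(2)[of n] that unfolding fits_def C_def g_def k_def by (simp add: case_prod_beta)
  have g: "g n \<in> carrier G" for n
    using good(1,4)[of n] openin_subset top by blast
  show False
  proof (rule strongly_aleph1_free_no_hom_systems[where g = g and k = k, OF H \<open>group G\<close> f g good(5)])
    show "y [^]\<^bsub>H\<^esub> k n \<noteq> f (g n)" if "y \<in> carrier H" for n y
      using good(6) that by blast
    fix S
    define F where "F n z = (if n \<in> S then g n else \<one>\<^bsub>G\<^esub>) \<otimes>\<^bsub>G\<^esub> z [^]\<^bsub>G\<^esub> k n" for n z
    have "continuous_map T T (F n)" for n
      unfolding F_def using g by (intro topological_group_mult_pow[OF G]) simp
    moreover have "F n ` C (Suc n) \<subseteq> C n" for n
      using fits by (auto simp: F_def)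
    moreover have "C n \<noteq> {}" for n
      using good(3) by blast
    ultimately have "\<exists>x. \<forall>n. x n \<in> C n \<and> x n = F n (x (Suc n))"
      by (intro compact_inverse_sequence[OF haus good(2)])
    then obtain x where x: "\<And>n. x n \<in> C n" "\<And>n. x n = F n (x (Suc n))"
      by blast
    have "x n \<in> carrier G" for n
      using x(1)[of n] compactin_subset_topspace[OF good(2)[of n]] top by blast
    with x(2) show "\<exists>x. \<forall>n. x n \<in> carrier G \<and>
        x n = (if n \<in> S then g n else \<one>\<^bsub>G\<^esub>) \<otimes>\<^bsub>G\<^esub> x (Suc n) [^]\<^bsub>G\<^esub> k n"
      unfolding F_def by blast
  qed
qed

section \<open>Completely metrizable groups\<close>

lemma strongly_aleph1_free_cm_slender:
  fixes H :: "('a, 'm) monoid_scheme"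
  assumes H: "strongly_aleph1_free_abelian H"
  shows "cm_slender H TYPE('g \<times> 'n)"
  unfolding cm_slender_def
proof (intro allI impI, elim conjE, rule ccontr)
  fix G :: "('g, 'n) monoid_scheme" and T f
  assume G: "topological_group G T" and cm: "completely_metrizable_space T"
    and f: "f \<in> hom G H" and ker: "\<not> openin T (kernel G H f)"
  have H1: "aleph1_free_abelian H"
    using H by (simp add: strongly_aleph1_free_abelian_def)
  have top: "topspace T = carrier G" and "group G"
    using G by (auto simp: topological_group_def)
  then interpret group G
    by simp
  obtain M d where "Metric_space M d" and comp: "Metric_space.mcomplete M d"
    and T: "T = Metric_space.mtopology M d"
    using cm completely_metrizable_space_def by blast
  then interpret Metric_space M d
    by simp
  have M: "M = carrier G"
    using top by (simp add: T)
  (* The metric need not be invariant, so g n has to be close to the identity through each of the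
     finitely many compositions of earlier maps; Phi collects these, for all sets S at once. *)
  define good where "good = (\<lambda>n::nat. \<lambda>(\<Phi>, g, k::nat). finite \<Phi> \<and> (\<lambda>z. z) \<in> \<Phi>
    \<and> (\<forall>\<theta>\<in>\<Phi>. continuous_map T T \<theta> \<and> d (\<theta> \<one>\<^bsub>G\<^esub>) (\<theta> g) < (1/2) ^ n)
    \<and> g \<in> carrier G \<and> 0 < k \<and> (\<forall>y\<in>carrier H. y [^]\<^bsub>H\<^esub> k \<noteq> f g))"
  \<comment> \<open>Each recorded map is continued by both candidates for the next factor; the
    collection stays finite and still covers all \<open>S\<close>.\<close>
  define fits where "fits = (\<lambda>(\<Phi>, g, k) (\<Phi>', g' :: 'g, k' :: nat).
    \<forall>\<theta>\<in>\<Phi>. (\<lambda>z. \<theta> (g \<otimes>\<^bsub>G\<^esub> z [^]\<^bsub>G\<^esub> (k::nat))) \<in> \<Phi>' \<and> (\<lambda>z. \<theta> (\<one>\<^bsub>G\<^esub> \<otimes>\<^bsub>G\<^esub> z [^]\<^bsub>G\<^esub> k) :: 'g) \<in> \<Phi>')"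
  have next_good: "\<exists>g k. good n (\<Phi>, g, k)"
    if fin: "finite \<Phi>" and "(\<lambda>z. z) \<in> \<Phi>" and cont: "\<And>\<theta>. \<theta> \<in> \<Phi> \<Longrightarrow> continuous_map T T \<theta>" for n \<Phi>
  proof -
    have memM: "\<theta> z \<in> M" if "\<theta> \<in> \<Phi>" "z \<in> M" for \<theta> z
      using continuous_map_image_subset_topspace[OF cont[OF that(1)]] that(2) top M by auto
    let ?V = "\<lambda>\<theta>. {z \<in> topspace T. \<theta> z \<in> mball (\<theta> \<one>\<^bsub>G\<^esub>) ((1/2) ^ n)}"
    let ?W = "(\<Inter>\<theta>\<in>\<Phi>. ?V \<theta>) \<inter> topspace T"
    have "openin T (mball x r)" for x r
      by (simp add: T)
    then have "openin T ?W"
      by (intro openin_INT fin openin_continuous_map_preimage[OF cont])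
    moreover have "\<one>\<^bsub>G\<^esub> \<in> M"
      by (simp add: M)
    then have "\<one>\<^bsub>G\<^esub> \<in> ?W"
      using memM \<open>\<one>\<^bsub>G\<^esub> \<in> M\<close> by (auto simp: top simp flip: M)
    ultimately obtain g k where "g \<in> ?W" "0 < (k::nat)" "\<forall>y\<in>carrier H. y [^]\<^bsub>H\<^esub> k \<noteq> f g"
      using nonopen_kernel_indivisible[OF H1 G f ker, of ?W] by blast
    with that have "good n (\<Phi>, g, k)"
      by (auto simp: good_def top)
    then show ?thesis
      by blast
  qed
  have "\<exists>s. \<forall>n::nat. good n (s n) \<and> fits (s n) (s (Suc n))"
  proof (rule dependent_nat_choice)
    show "\<exists>x. good 0 x"
      using next_good[of "{\<lambda>z. z}" 0] by auto
  next
    fix s :: "('g \<Rightarrow> 'g) set \<times> 'g \<times> nat" and n :: nat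
    obtain \<Phi> g k where s: "s = (\<Phi>, g, k)"
      by (cases s)
    assume "good n s"
    then have fin: "finite \<Phi>" and cont: "\<And>\<theta>. \<theta> \<in> \<Phi> \<Longrightarrow> continuous_map T T \<theta>"
      and g: "g \<in> carrier G"
      by (auto simp: good_def s)
    \<comment> \<open>The identity is added so that compositions starting at the new index are
      recorded as well.\<close>
    define \<Phi>' where "\<Phi>' = insert (\<lambda>z. z) ((\<lambda>\<theta> z. \<theta> (g \<otimes>\<^bsub>G\<^esub> z [^]\<^bsub>G\<^esub> k)) ` \<Phi>
      \<union> (\<lambda>\<theta> z. \<theta> (\<one>\<^bsub>G\<^esub> \<otimes>\<^bsub>G\<^esub> z [^]\<^bsub>G\<^esub> k)) ` \<Phi>)"
    have step: "continuous_map T T (\<lambda>z. \<theta> (a \<otimes>\<^bsub>G\<^esub> z [^]\<^bsub>G\<^esub> k))" if "\<theta> \<in> \<Phi>" "a \<in> carrier G" for \<theta> a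
      using continuous_map_compose[OF topological_group_mult_pow[OF G that(2)] cont[OF that(1)]]
      by (simp add: comp_def)
    have "continuous_map T T \<theta>" if "\<theta> \<in> \<Phi>'" for \<theta>
      using that step g unfolding \<Phi>'_def by auto
    then obtain g' k' where good: "good (Suc n) (\<Phi>', g', k')"
      using next_good[of \<Phi>' "Suc n"] fin by (auto simp: \<Phi>'_def)
    have "fits s (\<Phi>', g', k')"
      unfolding fits_def s \<Phi>'_def by simp
    with good show "\<exists>y. good (Suc n) y \<and> fits s y"
      by blast
  qed
  then obtain s where s: "\<And>n::nat. good n (s n)" "\<And>n. fits (s n) (s (Suc n))"
    by blast
  define \<Phi> where "\<Phi> n = fst (s n)" for n
  define g where "g n = fst (snd (s n))" for n
  define k where "k n = snd (snd (s n))" for n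
  have good: "(\<lambda>z. z) \<in> \<Phi> n" "\<And>\<theta>. \<theta> \<in> \<Phi> n \<Longrightarrow> continuous_map T T \<theta>"
      "\<And>\<theta>. \<theta> \<in> \<Phi> n \<Longrightarrow> d (\<theta> \<one>\<^bsub>G\<^esub>) (\<theta> (g n)) < (1/2) ^ n" "g n \<in> carrier G" "0 < k n"
      "\<forall>y\<in>carrier H. y [^]\<^bsub>H\<^esub> k n \<noteq> f (g n)" for n
    using s(1)[of n] unfolding good_def \<Phi>_def g_def k_def by (simp_all add: case_prod_beta)
  have fits: "(\<lambda>z. \<theta> (g n \<otimes>\<^bsub>G\<^esub> z [^]\<^bsub>G\<^esub> k n)) \<in> \<Phi> (Suc n) \<and> (\<lambda>z. \<theta> (\<one>\<^bsub>G\<^esub> \<otimes>\<^bsub>G\<^esub> z [^]\<^bsub>G\<^esub> k n)) \<in> \<Phi> (Suc n)"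
    if "\<theta> \<in> \<Phi> n" for n \<theta>
    using s(2)[of n] that unfolding fits_def \<Phi>_def g_def k_def by (simp add: case_prod_beta)
  show False
  proof (rule strongly_aleph1_free_no_hom_systems[where g = g and k = k, OF H \<open>group G\<close> f good(4,5)])
    show "y [^]\<^bsub>H\<^esub> k n \<noteq> f (g n)" if "y \<in> carrier H" for n y
      using good(6) that by blast
    fix S
    define F where "F n z = (if n \<in> S then g n else \<one>\<^bsub>G\<^esub>) \<otimes>\<^bsub>G\<^esub> z [^]\<^bsub>G\<^esub> k n" for n z
    have F: "continuous_map T T (F n)" for n
      unfolding F_def using good(4) by (intro topological_group_mult_pow[OF G]) simp
    \<comment> \<open>Whatever \<open>S\<close> is, the composition of the maps with indices from
      \<open>n\<close> below \<open>n + j\<close> was already recorded when \<open>g (n + j)\<close>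
      was chosen.\<close>
    have tele: "telescope F n j \<in> \<Phi> (n + j)" for n j
    proof (induction j)
      case 0
      have "telescope F n 0 = (\<lambda>z. z)"
        by (rule ext) simp
      then show ?case
        using good(1) by (simp del: telescope.simps)
    next
      case (Suc j)
      have "telescope F n (Suc j) = (\<lambda>z. telescope F n j (F (n + j) z))"
        by (rule ext) (rule telescope_Suc_right)
      also have "\<dots> \<in> \<Phi> (Suc (n + j))"
        using fits[OF Suc] by (cases "n + j \<in> S") (simp_all add: F_def[of "n + j"])
      finally show ?case
        by (simp del: telescope.simps)
    qed
    \<comment> \<open>The innermost map sends 1 to \<open>g (n + j)\<close> or to 1, so one recorded
      map is compared at 1 and at one of these two points.\<close>
    have "d (telescope F n j \<one>\<^bsub>G\<^esub>) (telescope F n (Suc j) \<one>\<^bsub>G\<^esub>) < (1/2) ^ (n + j)" for n j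
    proof -
      have "telescope F n j \<one>\<^bsub>G\<^esub> \<in> M"
        using continuous_map_image_subset_topspace[OF good(2)[OF tele[of n j]]] one_closed
        unfolding top M by blast
      moreover have "F (n + j) \<one>\<^bsub>G\<^esub> = (if n + j \<in> S then g (n + j) else \<one>\<^bsub>G\<^esub>)"
        using good(4) by (simp add: F_def)
      ultimately show ?thesis
        using good(3)[OF tele] by (simp add: telescope_Suc_right del: telescope.simps)
    qed
    then have "\<exists>x. \<forall>n. x n \<in> M \<and> x n = F n (x (Suc n))"
      using F by (intro mcomplete_inverse_sequence[OF comp, of "\<one>\<^bsub>G\<^esub>"]) (simp_all add: M T)
    then show "\<exists>x. \<forall>n. x n \<in> carrier G \<and>
        x n = (if n \<in> S then g n else \<one>\<^bsub>G\<^esub>) \<otimes>\<^bsub>G\<^esub> x (Suc n) [^]\<^bsub>G\<^esub> k n"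
      unfolding F_def M .
  qed
qed

section \<open>The Hawaiian earring group\<close>

lemma inv_letter_inv_letter [simp]: "inv_letter (inv_letter x) = x"
  by (simp add: inv_letter_def)

text \<open>Left multiplication by a letter acting on reduced words, as in van der Waerden's
  argument for normal forms in free groups. \<open>free_reduce\<close> applies this action to the
  empty word.\<close>

definition reduce_Cons :: "letter \<Rightarrow> letter list \<Rightarrow> letter list" where
  "reduce_Cons x zs = (case zs of [] \<Rightarrow> [x]
    | y # ys \<Rightarrow> (if y = inv_letter x then ys else x # y # ys))"

abbreviation reduced :: "letter list \<Rightarrow> bool" where
  "reduced \<equiv> successively (\<lambda>x y. y \<noteq> inv_letter x)"

lemma free_reduce_eq_foldr: "free_reduce xs = foldr reduce_Cons xs []"
  by (induction xs) (auto simp: reduce_Cons_def)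

lemma reduced_reduce_Cons: "reduced zs \<Longrightarrow> reduced (reduce_Cons x zs)"
  by (auto simp: reduce_Cons_def successively_Cons split: list.splits)

lemma reduced_foldr: "reduced zs \<Longrightarrow> reduced (foldr reduce_Cons xs zs)"
  by (induction xs) (auto intro: reduced_reduce_Cons)

text \<open>If \<open>zs\<close> starts with \<open>x\<close>, the inner step deletes that letter;
  since \<open>zs\<close> is reduced, the remainder does not start with the inverse of
  \<open>x\<close>, so the outer step puts \<open>x\<close> back.\<close>

lemma reduce_Cons_cancel: "reduced zs \<Longrightarrow> reduce_Cons x (reduce_Cons (inv_letter x) zs) = zs"
  by (cases zs; cases "tl zs") (auto simp: reduce_Cons_def successively_Cons)

text \<open>Cancelling pairs act trivially on reduced words, so a word acts as its reduction
  does.\<close>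

lemma foldr_reduce_Cons_free_reduce:
  assumes "reduced zs"
  shows "foldr reduce_Cons xs zs = foldr reduce_Cons (free_reduce xs) zs"
proof (induction xs)
  case (Cons x xs)
  show ?case
  proof (cases "free_reduce xs")
    case (Cons y ys)
    with Cons.IH show ?thesis
      using reduce_Cons_cancel[OF reduced_foldr[OF assms]] by auto
  qed (use Cons.IH in simp)
qed simp

text \<open>The right side depends on the two reductions only; hence concatenation respects
  equivalence of words.\<close>

lemma free_reduce_append:
  "free_reduce (xs @ ys) = foldr reduce_Cons (free_reduce xs) (free_reduce ys)"
  using foldr_reduce_Cons_free_reduce[of "free_reduce ys" xs] reduced_foldr[of "[]" ys]
  by (simp add: free_reduce_eq_foldr)

section \<open>Finite projections and concatenation of infinite words\<close>

definition letters_le :: "nat \<Rightarrow> hword \<Rightarrow> rat set" where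
  "letters_le m W = {q. \<exists>l. W q = Some l \<and> fst l \<le> m}"

lemma proj_list_eq:
  "proj_list m W = map (\<lambda>q. the (W q)) (sorted_list_of_set (letters_le m W))"
  by (simp add: proj_list_def letters_le_def)

lemma is_hword_iff: "is_hword W \<longleftrightarrow> (\<forall>m. finite (letters_le m W))"
  by (simp add: is_hword_def letters_le_def)

lemma sorted_list_of_set_Un:
  assumes "finite A" "finite B" "\<And>a b. a \<in> A \<Longrightarrow> b \<in> B \<Longrightarrow> a < b"
  shows "sorted_list_of_set (A \<union> B) = sorted_list_of_set A @ sorted_list_of_set B"
proof (rule sorted_distinct_set_unique)
  show "distinct (sorted_list_of_set A @ sorted_list_of_set B)"
    using assms by (auto dest!: assms(3))
  show "sorted (sorted_list_of_set A @ sorted_list_of_set B)"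
    using assms by (auto simp: sorted_append intro: less_imp_le)
qed (use assms in auto)

lemma sorted_list_of_set_image_strict_mono:
  assumes "strict_mono s" "finite A"
  shows "sorted_list_of_set (s ` A) = map s (sorted_list_of_set A)"
proof (rule sorted_distinct_set_unique)
  show "sorted (map s (sorted_list_of_set A))"
    using assms by (simp add: sorted_map sorted_wrt_mono_rel[of _ "(\<le>)"] strict_mono_less_eq)
  show "distinct (map s (sorted_list_of_set A))"
    using assms by (simp add: distinct_map strict_mono_imp_inj_on)
qed (use assms in auto)

lemma proj_list_split:
  assumes "finite (letters_le m W)" "\<And>a b. W a \<noteq> None \<Longrightarrow> W b \<noteq> None \<Longrightarrow> a \<in> A \<Longrightarrow> b \<notin> A \<Longrightarrow> a < b"
  shows "proj_list m W = proj_list m (W |` A) @ proj_list m (W |` (- A))"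
proof -
  have eq: "letters_le m W = letters_le m (W |` A) \<union> letters_le m (W |` (- A))"
    by (auto simp: letters_le_def restrict_map_def split: if_splits)
  have fin: "finite (letters_le m (W |` A))" "finite (letters_le m (W |` (- A)))"
    using assms(1) unfolding eq by auto
  have "sorted_list_of_set (letters_le m W) =
      sorted_list_of_set (letters_le m (W |` A)) @ sorted_list_of_set (letters_le m (W |` (- A)))"
    unfolding eq
    by (rule sorted_list_of_set_Un[OF fin], rule assms(2))
      (auto simp: letters_le_def restrict_map_def split: if_splits)
  moreover have "(W |` B) q = W q" if "q \<in> letters_le m (W |` B)" for B q
    using that by (auto simp: letters_le_def restrict_map_def split: if_splits)
  ultimately show ?thesis
    using fin by (simp add: proj_list_eq cong: map_cong)
qed

lemma letters_le_reindex:
  assumes "strict_mono s" "\<And>q. W (s q) = U q" "\<And>q. W q \<noteq> None \<Longrightarrow> q \<in> range s"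
  shows "letters_le m W = s ` letters_le m U"
  using assms(2,3) unfolding letters_le_def by (auto simp: image_iff) (metis option.distinct(1) rangeE)+

text \<open>Projections see only the order type: \<open>s\<close> embeds the order and reaches every
  occupied position of \<open>W\<close>.\<close>

lemma proj_list_reindex:
  assumes "strict_mono s" "\<And>q. W (s q) = U q" "\<And>q. W q \<noteq> None \<Longrightarrow> q \<in> range s"
    and "finite (letters_le m U)"
  shows "proj_list m W = proj_list m U"
  unfolding proj_list_eq letters_le_reindex[where s = s and W = W and U = U, OF assms(1) assms(2) assms(3), simplified]
  using assms by (simp add: sorted_list_of_set_image_strict_mono comp_def)

lemma strict_mono_squash: "strict_mono squash"
proof (rule strict_monoI)
  fix p q :: rat assume "p < q"
  \<comment> \<open>What remains of the claim after clearing denominators and removing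
    \<open>p < q\<close>. For equal signs the two products agree; otherwise they are separated by
    0.\<close>
  moreover have "p * \<bar>q\<bar> \<le> q * \<bar>p\<bar>"
  proof (cases "0 \<le> p \<or> q \<le> 0")
    case False
    then have "p * \<bar>q\<bar> \<le> 0" "0 \<le> q * \<bar>p\<bar>"
      by (simp_all add: mult_le_0_iff)
    then show ?thesis
      by (rule order_trans)
  qed (use \<open>p < q\<close> in auto)
  ultimately have "p * (1 + \<bar>q\<bar>) < q * (1 + \<bar>p\<bar>)"
    by (simp add: distrib_left)
  moreover have "0 < 1 + \<bar>p\<bar>" "0 < 1 + \<bar>q\<bar>"
    by (simp_all add: add_pos_nonneg)
  ultimately show "squash p < squash q"
    by (simp add: squash_def pos_divide_less_eq pos_less_divide_eq)
qed

lemma squash_bounds: "- 1 < squash q" "squash q < 1"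
  by (auto simp: squash_def field_simps abs_if)

lemma hw_concat_left: "hw_concat W U (squash r - 1) = W r"
proof -
  have "(THE r'. squash r' = squash r) = r"
    using strict_mono_squash by (simp add: strict_mono_eq)
  then show ?thesis
    using squash_bounds[of r] by (auto simp: hw_concat_def)
qed

lemma hw_concat_right: "hw_concat W U (squash r + 1) = U r"
proof -
  have "(THE r'. squash r' = squash r) = r"
    using strict_mono_squash by (simp add: strict_mono_eq)
  then show ?thesis
    using squash_bounds[of r] by (auto simp: hw_concat_def)
qed

text \<open>Which factor a position belongs to does not depend on the words, so one case split
  treats several concatenations at once.\<close>

lemma hw_concat_cases:
  obtains (left) r where "q = squash r - 1" "q < 0"
  | (right) r where "q = squash r + 1" "0 < q"
  | (none) "\<And>W U. hw_concat W U q = None"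
proof -
  consider r where "q < 0" "q = squash r - 1" | r where "\<not> q < 0" "q = squash r + 1"
    | "\<And>W U. hw_concat W U q = None"
  proof (cases "\<exists>r. q < 0 \<and> q = squash r - 1 \<or> \<not> q < 0 \<and> q = squash r + 1")
    case False
    then have "hw_concat W U q = None" for W U
      unfolding hw_concat_def by metis
    then show thesis
      using that(3) by blast
  qed (use that in blast)
  then show thesis
  proof cases
    case (2 r)
    then show thesis
      using right[of r] squash_bounds[of r] by simp
  qed (use left none in blast)+
qed

lemma letters_le_hw_concat:
  "letters_le m (hw_concat W U) =
    (\<lambda>r. squash r - 1) ` letters_le m W \<union> (\<lambda>r. squash r + 1) ` letters_le m U" (is "?L = ?R")
proof
  show "?L \<subseteq> ?R"
  proof
    fix q assume q: "q \<in> ?L"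
    show "q \<in> ?R"
      using q by (cases q rule: hw_concat_cases)
        (auto simp: letters_le_def hw_concat_left hw_concat_right)
  qed
  show "?R \<subseteq> ?L"
    by (auto simp: letters_le_def hw_concat_left hw_concat_right)
qed

lemma is_hword_hw_concat:
  "is_hword W \<Longrightarrow> is_hword U \<Longrightarrow> is_hword (hw_concat W U)"
  by (simp add: is_hword_iff letters_le_hw_concat)

lemma proj_list_hw_concat:
  assumes "finite (letters_le m W)" "finite (letters_le m U)"
  shows "proj_list m (hw_concat W U) = proj_list m W @ proj_list m U"
proof -
  let ?V = "hw_concat W U"
  have "proj_list m ?V = proj_list m (?V |` {..<0}) @ proj_list m (?V |` (- {..<0}))"
    by (rule proj_list_split) (use assms in \<open>auto simp: letters_le_hw_concat\<close>)
  also have "proj_list m (?V |` {..<0}) = proj_list m W"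
  proof (rule proj_list_reindex[where s = "\<lambda>r. squash r - 1"])
    show "strict_mono (\<lambda>r. squash r - 1)"
      using strict_mono_squash by (simp add: strict_mono_def)
    show "(?V |` {..<0}) (squash q - 1) = W q" for q
      using squash_bounds[of q] by (simp add: hw_concat_left)
    show "q \<in> range (\<lambda>r. squash r - 1)" if "(?V |` {..<0}) q \<noteq> None" for q
      using that by (cases q rule: hw_concat_cases) (auto simp: restrict_map_def split: if_splits)
  qed (fact assms)
  also have "proj_list m (?V |` (- {..<0})) = proj_list m U"
  proof (rule proj_list_reindex[where s = "\<lambda>r. squash r + 1"])
    show "strict_mono (\<lambda>r. squash r + 1)"
      using strict_mono_squash by (simp add: strict_mono_def)
    show "(?V |` (- {..<0})) (squash q + 1) = U q" for q
      using squash_bounds[of q] by (simp add: hw_concat_right)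
    show "q \<in> range (\<lambda>r. squash r + 1)" if "(?V |` (- {..<0})) q \<noteq> None" for q
      using that by (cases q rule: hw_concat_cases) (auto simp: restrict_map_def split: if_splits)
  qed (fact assms)
  finally show ?thesis .
qed

section \<open>Classes of words and their product\<close>

lemma hw_class_eq: "hw_equiv W U \<Longrightarrow> hw_class W = hw_class U"
  by (simp add: hw_class_def hw_equiv_def)

lemma hw_class_eqI: "(\<And>m. proj_list m W = proj_list m U) \<Longrightarrow> hw_class W = hw_class U"
  by (simp add: hw_class_def hw_equiv_def)

lemma hw_rep_hw_class:
  assumes "is_hword W"
  shows "is_hword (hw_rep (hw_class W))" "hw_class (hw_rep (hw_class W)) = hw_class W"
    and "hw_equiv W (hw_rep (hw_class W))"
proof -
  have "W \<in> hw_class W"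
    using assms by (simp add: hw_class_def hw_equiv_def)
  then have "hw_rep (hw_class W) \<in> hw_class W"
    unfolding hw_rep_def by (rule someI[of "\<lambda>V. V \<in> hw_class W"])
  then show "is_hword (hw_rep (hw_class W))" and eq: "hw_equiv W (hw_rep (hw_class W))"
    by (simp_all add: hw_class_def)
  from eq show "hw_class (hw_rep (hw_class W)) = hw_class W"
    by (rule hw_class_eq[symmetric])
qed

lemma hw_equiv_hw_concat:
  assumes "is_hword W" "is_hword W'" "is_hword U" "is_hword U'" "hw_equiv W W'" "hw_equiv U U'"
  shows "hw_equiv (hw_concat W U) (hw_concat W' U')"
  using assms by (simp add: hw_equiv_def is_hword_iff proj_list_hw_concat free_reduce_append)

lemma hw_class_in_hawaiian: "is_hword W \<Longrightarrow> hw_class W \<in> carrier hawaiian"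
  by (simp add: hawaiian_def)

text \<open>Multiplication is defined through chosen representatives; congruence of concatenation
  removes the choice.\<close>

lemma hawaiian_mult_hw_class:
  assumes "is_hword W" "is_hword U"
  shows "hw_class W \<otimes>\<^bsub>hawaiian\<^esub> hw_class U = hw_class (hw_concat W U)"
proof -
  have "hw_equiv (hw_concat W U) (hw_concat (hw_rep (hw_class W)) (hw_rep (hw_class U)))"
    using assms by (intro hw_equiv_hw_concat hw_rep_hw_class)
  from hw_class_eq[OF this] show ?thesis
    by (simp add: hawaiian_def)
qed

lemma letters_le_restrict: "letters_le m (W |` A) = letters_le m W \<inter> A"
  by (auto simp: letters_le_def restrict_map_def)

lemma is_hword_restrict: "is_hword W \<Longrightarrow> is_hword (W |` A)"
  by (simp add: is_hword_iff letters_le_restrict)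

lemma is_hword_empty: "is_hword (\<lambda>_. None)"
  by (simp add: is_hword_def)

primrec hw_pow :: "hword \<Rightarrow> nat \<Rightarrow> hword" where
  "hw_pow W 0 = (\<lambda>_. None)"
| "hw_pow W (Suc k) = hw_concat W (hw_pow W k)"

lemma is_hword_hw_pow: "is_hword W \<Longrightarrow> is_hword (hw_pow W k)"
  by (induction k) (auto intro: is_hword_hw_concat is_hword_empty)

section \<open>Homomorphisms from the Hawaiian earring group to abelian groups\<close>

locale hawaiian_hom = comm_group H for H (structure) +
  fixes \<phi>
  assumes hom: "\<phi> \<in> hom hawaiian H"
begin

lemma closed: "is_hword W \<Longrightarrow> \<phi> (hw_class W) \<in> carrier H"
  using hom hw_class_in_hawaiian by (auto simp: hom_def)

lemma hom_concat:
  "is_hword W \<Longrightarrow> is_hword U \<Longrightarrow>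
    \<phi> (hw_class (hw_concat W U)) = \<phi> (hw_class W) \<otimes> \<phi> (hw_class U)"
  using hom hw_class_in_hawaiian by (simp add: hom_def flip: hawaiian_mult_hw_class)

lemma hom_empty: "\<phi> (hw_class (\<lambda>_. None)) = \<one>"
proof -
  let ?E = "\<lambda>_. None :: letter option"
  \<comment> \<open>The image of the empty word is idempotent, hence trivial.\<close>
  have "hw_class (hw_concat ?E ?E) = hw_class ?E"
    by (rule hw_class_eqI) (simp add: proj_list_eq letters_le_hw_concat, simp add: letters_le_def)
  then have "\<phi> (hw_class ?E) \<otimes> \<phi> (hw_class ?E) = \<phi> (hw_class ?E)"
    using hom_concat[OF is_hword_empty is_hword_empty] by simp
  then show ?thesis
    using closed[OF is_hword_empty] by simp
qed

lemma hom_pow: "is_hword W \<Longrightarrow> \<phi> (hw_class (hw_pow W k)) = \<phi> (hw_class W) [^] k"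
  by (induction k) (simp_all add: hom_empty hom_concat is_hword_hw_pow closed m_comm)

lemma hom_cut:
  assumes W: "is_hword W"
    and cut: "\<And>a b. W a \<noteq> None \<Longrightarrow> W b \<noteq> None \<Longrightarrow> a \<in> A \<Longrightarrow> b \<notin> A \<Longrightarrow> a < b"
  shows "\<phi> (hw_class W) = \<phi> (hw_class (W |` A)) \<otimes> \<phi> (hw_class (W |` (- A)))"
proof -
  have "hw_class W = hw_class (hw_concat (W |` A) (W |` (- A)))"
  proof (rule hw_class_eqI)
    fix m
    have fin: "finite (letters_le m W)"
      using W by (simp add: is_hword_iff)
    then show "proj_list m W = proj_list m (hw_concat (W |` A) (W |` (- A)))"
      using proj_list_split[OF fin cut, of A] by (simp add: proj_list_hw_concat letters_le_restrict)
  qed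
  then show ?thesis
    using hom_concat is_hword_restrict[OF W] by simp
qed

text \<open>The positions in \<open>F\<close> may be interleaved with the others. Cutting at the
  greatest one and treating the part below by induction isolates them one at a time; commutativity
  of \<open>H\<close> then gathers the pieces.\<close>

lemma hom_restrict_finite:
  assumes "finite F" "is_hword W"
  shows "\<phi> (hw_class W) = \<phi> (hw_class (W |` F)) \<otimes> \<phi> (hw_class (W |` (- F)))"
  using assms
proof (induction F arbitrary: W rule: finite_linorder_max_induct)
  case empty
  then show ?case
    by (simp add: hom_empty closed)
next
  case (insert q F)
  let ?f = "\<lambda>A. \<phi> (hw_class (W |` A))"
  note W = \<open>is_hword W\<close>
  \<comment> \<open>With all pieces written as restrictions of one word, cutting becomes a
    computation with sets of positions.\<close>
  have cut: "?f B = ?f C \<otimes> ?f D"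
    if "\<And>a b. a \<in> A \<Longrightarrow> b \<notin> A \<Longrightarrow> a < b" "B \<inter> A = C" "B \<inter> - A = D" for A B C D
  proof -
    have "?f B = \<phi> (hw_class (W |` B |` A)) \<otimes> \<phi> (hw_class (W |` B |` (- A)))"
      by (rule hom_cut[OF is_hword_restrict[OF W]]) (rule that(1))
    then show ?thesis
      by (simp only: Map.restrict_restrict that)
  qed
  have [simp]: "?f A \<in> carrier H" for A
    using W by (simp add: closed is_hword_restrict)
  have "W |` UNIV = W"
    by (simp add: restrict_map_def)
  then have W1: "\<phi> (hw_class W) = ?f UNIV"
    by simp
  have W2: "?f UNIV = ?f {..<q} \<otimes> ?f {q..}"
    by (rule cut[of "{..<q}"]) auto
  have W3: "?f {q..} = ?f {q} \<otimes> ?f {q<..}"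
    by (rule cut[of "{..q}"]) auto
  have below: "F \<subseteq> {..<q}"
    using insert.hyps by blast
  then have "{..<q} \<inter> F = F"
    using below by blast
  then have W4: "?f {..<q} = ?f F \<otimes> ?f ({..<q} - F)"
    using insert.IH[OF is_hword_restrict[OF W], of "{..<q}"]
    by (simp only: Map.restrict_restrict Diff_eq)
  have W5: "?f (insert q F) = ?f F \<otimes> ?f {q}"
  proof (rule cut[of "{..<q}"])
    show "insert q F \<inter> {..<q} = F" "insert q F \<inter> - {..<q} = {q}"
      using below by force+
  qed simp
  have W6: "?f (- insert q F) = ?f ({..<q} - F) \<otimes> ?f {q<..}"
  proof (rule cut[of "{..<q}"])
    show "- insert q F \<inter> {..<q} = {..<q} - F" "- insert q F \<inter> - {..<q} = {q<..}"
      using below by force+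
  qed simp
  show ?case
    unfolding W1 W2 W3 W4 W5 W6 by (simp add: m_ac)
qed

text \<open>Letters of index at most \<open>m\<close> occupy finitely many positions; split these
  off, and the rest is killed. Contrapositively, failure of slenderness at \<open>m\<close> yields a
  word without these letters and with nontrivial image.\<close>

lemma hom_hawaiian_proj:
  assumes x: "x \<in> carrier hawaiian"
    and kill: "\<And>U. is_hword U \<Longrightarrow> letters_le m U = {} \<Longrightarrow> \<phi> (hw_class U) = \<one>"
  shows "\<phi> x = \<phi> (hawaiian_proj m x)"
proof -
  define R where "R = hw_rep x"
  have R: "is_hword R" "hw_class R = x"
  proof -
    obtain W where "is_hword W" "x = hw_class W"
      using x by (auto simp: hawaiian_def)
    then show "is_hword R" "hw_class R = x"
      by (simp_all add: R_def hw_rep_hw_class)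
  qed
  have fin: "finite (letters_le m R)"
    using R by (simp add: is_hword_iff)
  have proj: "hawaiian_proj m x = hw_class (R |` letters_le m R)"
    unfolding hawaiian_proj_def R_def[symmetric]
    by (rule arg_cong[where f = hw_class])
      (auto simp: hw_restrict_def restrict_map_def letters_le_def split: option.split)
  have "\<phi> x = \<phi> (hw_class (R |` letters_le m R)) \<otimes> \<phi> (hw_class (R |` (- letters_le m R)))"
    using hom_restrict_finite[OF fin R(1)] R(2) by simp
  also have "\<phi> (hw_class (R |` (- letters_le m R))) = \<one>"
  proof (rule kill)
    show "is_hword (R |` (- letters_le m R))"
      using R(1) by (rule is_hword_restrict)
    show "letters_le m (R |` (- letters_le m R)) = {}"
      by (simp add: letters_le_restrict)
  qed
  finally show ?thesis
    using R by (simp add: proj closed is_hword_restrict)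
qed

end

text \<open>Words with \<open>X n = U n \<cdot> (X (n + 1)) ^ k n\<close> for all \<open>n\<close> are obtained as unions of the
  finite unfoldings of this recursion, which increase because \<open>hw_concat\<close> fixes positions.\<close>

primrec hw_unfold :: "(nat \<Rightarrow> hword) \<Rightarrow> (nat \<Rightarrow> nat) \<Rightarrow> nat \<Rightarrow> nat \<Rightarrow> hword" where
  "hw_unfold U k 0 n = (\<lambda>_. None)"
| "hw_unfold U k (Suc d) n = hw_concat (U n) (hw_pow (hw_unfold U k d (Suc n)) (k n))"

lemma hw_concat_mono: "W \<subseteq>\<^sub>m W' \<Longrightarrow> U \<subseteq>\<^sub>m U' \<Longrightarrow> hw_concat W U \<subseteq>\<^sub>m hw_concat W' U'"
  unfolding map_le_def
proof safe
  fix q y assume *: "\<forall>a\<in>dom W. W a = W' a" "\<forall>a\<in>dom U. U a = U' a" "hw_concat W U q = Some y"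
  then show "hw_concat W U q = hw_concat W' U' q"
    by (cases q rule: hw_concat_cases) (auto simp: hw_concat_left hw_concat_right dom_def)
qed

lemma hw_pow_mono: "W \<subseteq>\<^sub>m W' \<Longrightarrow> hw_pow W k \<subseteq>\<^sub>m hw_pow W' k"
  by (induction k) (auto intro: hw_concat_mono)

lemma hw_unfold_mono: "hw_unfold U k d n \<subseteq>\<^sub>m hw_unfold U k (Suc d) n"
proof (induction d arbitrary: n)
  case (Suc d)
  show ?case
    using hw_concat_mono[OF map_le_refl hw_pow_mono[OF Suc.IH]] by simp
qed simp

text \<open>Each position reads at most one position of one factor, so pointwise stabilisation
  survives concatenation.\<close>

lemma eventually_hw_concat:
  assumes "\<And>q. \<forall>\<^sub>F d in F. A d q = A' q" "\<And>q. \<forall>\<^sub>F d in F. B d q = B' q"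
  shows "\<forall>\<^sub>F d in F. hw_concat (A d) (B d) q = hw_concat A' B' q"
  by (cases q rule: hw_concat_cases) (simp_all add: hw_concat_left hw_concat_right assms)

lemma eventually_hw_pow:
  assumes "\<And>q. \<forall>\<^sub>F d in F. A d q = A' q"
  shows "\<forall>\<^sub>F d in F. hw_pow (A d) k q = hw_pow A' k q"
  by (induction k arbitrary: q) (simp_all add: eventually_hw_concat assms)

lemma letters_le_hw_pow: "letters_le m W = {} \<Longrightarrow> letters_le m (hw_pow W k) = {}"
  by (induction k) (simp_all add: letters_le_hw_concat, simp add: letters_le_def)

lemma finite_letters_le_hw_pow:
  "finite (letters_le m W) \<Longrightarrow> finite (letters_le m (hw_pow W k))"
  by (induction k) (simp_all add: letters_le_hw_concat, simp add: letters_le_def)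

lemma hw_recursion_solvable:
  assumes hw: "\<And>n. is_hword (U n)" and U: "\<And>n. letters_le n (U n) = {}"
  shows "\<exists>X. \<forall>n. is_hword (X n) \<and> X n = hw_concat (U n) (hw_pow (X (Suc n)) (k n))"
proof -
  \<comment> \<open>By monotonicity a position keeps its first letter forever or stays empty
    forever.\<close>
  have "\<exists>y. \<forall>\<^sub>F d in sequentially. hw_unfold U k d n q = y" for n q
  proof (cases "\<exists>d. hw_unfold U k d n q \<noteq> None")
    case True
    then obtain d where d: "hw_unfold U k d n q \<noteq> None"
      by blast
    have "hw_unfold U k e n q = hw_unfold U k d n q" if "d \<le> e" for e
      using that
    proof (induction e rule: dec_induct)
      case (step e)
      then show ?case
        using hw_unfold_mono[of U k e n] d unfolding map_le_def by (metis domIff)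
    qed simp
    then show ?thesis
      by (auto simp: eventually_sequentially)
  next
    case False
    then show ?thesis
      by (intro exI[of _ None] always_eventually) blast
  qed
  then have "\<exists>X. \<forall>n q. \<forall>\<^sub>F d in sequentially. hw_unfold U k d n q = X n q"
    by (intro choice allI)
  then obtain X where X: "\<And>n q. \<forall>\<^sub>F d in sequentially. hw_unfold U k d n q = X n q"
    by blast
  \<comment> \<open>Raising the depth by one does not change the limit, so the recursion of
    \<open>hw_unfold\<close> passes to \<open>X\<close>.\<close>
  have rec: "X n = hw_concat (U n) (hw_pow (X (Suc n)) (k n))" for n
  proof
    fix q
    have "\<forall>\<^sub>F d in sequentially. hw_unfold U k (Suc d) n q = X n q"
      using X[of n q] by (subst eventually_sequentially_Suc)
    moreover have "\<forall>\<^sub>F d in sequentially. hw_unfold U k (Suc d) n q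
        = hw_concat (U n) (hw_pow (X (Suc n)) (k n)) q"
      unfolding hw_unfold.simps by (intro eventually_hw_concat eventually_hw_pow X) simp
    ultimately have "\<forall>\<^sub>F d in sequentially. X n q = hw_concat (U n) (hw_pow (X (Suc n)) (k n)) q"
      by eventually_elim simp
    then show "X n q = hw_concat (U n) (hw_pow (X (Suc n)) (k n)) q"
      by simp
  qed
  have unf: "letters_le m (hw_unfold U k d n) = {}" if "m \<le> n" for d m n
    using that
  proof (induction d arbitrary: n)
    case (Suc d)
    have "letters_le m (U n) \<subseteq> letters_le n (U n)"
      using Suc.prems by (auto simp: letters_le_def)
    then show ?case
      using Suc by (simp add: letters_le_hw_concat letters_le_hw_pow U)
  qed (simp add: letters_le_def)
  have high: "letters_le m (X n) = {}" if "m \<le> n" for m n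
  proof (rule equals0I)
    fix q assume q: "q \<in> letters_le m (X n)"
    from X[of n q] obtain d where "hw_unfold U k d n q = X n q"
      by (auto simp: eventually_sequentially)
    with q have "q \<in> letters_le m (hw_unfold U k d n)"
      by (simp add: letters_le_def)
    with unf[OF that] show False
      by simp
  qed
  \<comment> \<open>From index \<open>m\<close> on, \<open>X\<close> has no letter of index at most
    \<open>m\<close>. Descending from \<open>m\<close> to \<open>n\<close>, each step adds the
    finitely many such letters of one \<open>U i\<close> and repeats the rest finitely
    often.\<close>
  have "finite (letters_le m (X n))" for m n
  proof (cases "n \<le> m")
    case True
    then show ?thesis
    proof (induction n rule: inc_induct)
      case (step n)
      then show ?case
        using hw[of n] rec[of n]
        by (simp add: is_hword_iff letters_le_hw_concat finite_letters_le_hw_pow)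
    qed (simp add: high)
  qed (simp add: high)
  then have "is_hword (X n)" for n
    by (simp add: is_hword_iff)
  with rec show ?thesis
    by blast
qed

section \<open>Slenderness with respect to the Hawaiian earring\<close>

lemma strongly_aleph1_free_n_slender:
  assumes H: "strongly_aleph1_free_abelian H"
  shows "n_slender H"
  unfolding n_slender_def
proof (rule ballI, rule ccontr)
  fix \<phi> assume hom: "\<phi> \<in> hom hawaiian H"
    and no: "\<not> (\<exists>m. \<forall>x\<in>carrier hawaiian. \<phi> x = \<phi> (hawaiian_proj m x))"
  have H1: "aleph1_free_abelian H"
    using H by (simp add: strongly_aleph1_free_abelian_def)
  then interpret comm_group H
    by (simp add: aleph1_free_abelian_def)
  interpret hawaiian_hom H \<phi>
    by unfold_locales (fact hom)
  have "\<exists>U. is_hword U \<and> letters_le n U = {} \<and> \<phi> (hw_class U) \<noteq> \<one>\<^bsub>H\<^esub>" for n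
  proof (rule ccontr)
    assume "\<not> ?thesis"
    then have "\<phi> x = \<phi> (hawaiian_proj n x)" if "x \<in> carrier hawaiian" for x
      using that by (intro hom_hawaiian_proj) auto
    with no show False
      by blast
  qed
  then obtain U where U: "\<And>n. is_hword (U n)" "\<And>n. letters_le n (U n) = {}"
      "\<And>n. \<phi> (hw_class (U n)) \<noteq> \<one>\<^bsub>H\<^esub>"
    by metis
  \<comment> \<open>The exponents are chosen after all the words: the word recursion is solvable for
    arbitrary \<open>k\<close>.\<close>
  have "\<exists>k::nat. 0 < k \<and> (\<forall>y \<in> carrier H. y [^]\<^bsub>H\<^esub> k \<noteq> \<phi> (hw_class (U n)))" for n
    using aleph1_free_abelian_not_divisible[OF H1 closed[OF U(1)] U(3)] .
  then obtain k :: "nat \<Rightarrow> nat" where k: "\<And>n. 0 < k n"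
      "\<And>n y. y \<in> carrier H \<Longrightarrow> y [^]\<^bsub>H\<^esub> k n \<noteq> \<phi> (hw_class (U n))"
    by metis
  show False
  proof (rule strongly_aleph1_free_no_systems[OF H closed[OF U(1)] k(1) k(2)])
    fix S
    define V where "V n = (if n \<in> S then U n else (\<lambda>_. None))" for n
    have V: "is_hword (V n)" "letters_le n (V n) = {}" for n
      using U by (auto simp: V_def is_hword_empty letters_le_def)
    obtain X where X: "\<And>n. is_hword (X n)"
        "\<And>n. X n = hw_concat (V n) (hw_pow (X (Suc n)) (k n))"
      using hw_recursion_solvable[of V k, OF V] by blast
    have "\<phi> (hw_class (X n)) = (if n \<in> S then \<phi> (hw_class (U n)) else \<one>\<^bsub>H\<^esub>)
        \<otimes>\<^bsub>H\<^esub> \<phi> (hw_class (X (Suc n))) [^]\<^bsub>H\<^esub> k n" for n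
    proof -
      have "\<phi> (hw_class (X n)) = \<phi> (hw_class (V n)) \<otimes>\<^bsub>H\<^esub> \<phi> (hw_class (X (Suc n))) [^]\<^bsub>H\<^esub> k n"
        using V(1) X(1)
        by (subst X(2)) (simp add: hom_concat hom_pow is_hword_hw_pow)
      then show ?thesis
        by (simp add: V_def hom_empty)
    qed
    then show "\<exists>x. \<forall>n. x n \<in> carrier H \<and> x n =
        (if n \<in> S then \<phi> (hw_class (U n)) else \<one>\<^bsub>H\<^esub>) \<otimes>\<^bsub>H\<^esub> x (Suc n) [^]\<^bsub>H\<^esub> k n"
      using closed[OF X(1)] by (intro exI[of _ "\<lambda>n. \<phi> (hw_class (X n))"] allI conjI)
  qed
qed

theorem theoremD:
  fixes H :: "('a, 'm) monoid_scheme"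
  assumes "strongly_aleph1_free_abelian H"
  shows "n_slender H \<and> cm_slender H TYPE('g \<times> 'n) \<and> lcH_slender H TYPE('k \<times> 'l)"
  using strongly_aleph1_free_n_slender[OF assms] strongly_aleph1_free_cm_slender[OF assms]
    strongly_aleph1_free_lcH_slender[OF assms] by blast

end
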